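(* Let $K\subset\mathbb{R}^6$ be an origin-symmetric convex body of revolution (around the $x_6$ axis) such that its radial function $\rho_K(t)$, written as a function of $t\in[0,1]$, the cosine of the angle with the axis of revolution, is of class $C^2$ in a neighborhood of $t=1$ and satisfies $\rho_K(1)+\rho_K'(1)=0$. Let $h(x)=\int_0^x\rho_K^5(t)(x^2-t^2)\,dt$, $k(1)=\int_0^1 t^2\rho_K^5(t)\,dt$, and $r(t)=\rho_K^5(t)$. If $$2k^2(1) < h(1)\,r(1),$$ then the intersection body $IK$ of $K$ is not a polar zonoid.
   Context: Let $n=6$. A convex body in $\mathbb{R}^n$ is a compact convex set with nonempty interior. The radial function of an origin-symmetric convex body $K$ is $\rho_K(\xi)=\max\{\lambda\ge 0:\lambda\xi\in K\}$, $\xi\in S^{n-1}$. If $K$ is an origin-symmetric convex body of revolution around the $x_n$ axis (i.e. invariant under all rotations fixing that axis), then $\rho_K(\sqrt{1-t^2}\,\xi,t)$ is independent of $\xi\in S^{n-2}$, and one writes $\rho_K(t)=\rho_K(\sqrt{1-t^2}\,\xi,t)$ for $0\le t\le 1$; thus $t$ is the cosine of the angle with the axis of revolution, $t=1$ corresponds to the axis of revolution and $t=0$ to the equator. Primes denote derivatives with respect to $t$; since $t$ ranges over $[0,1]$, neighborhoods of $t=1$ are taken in $[0,1]$ and derivatives at $t=1$ are one-sided. The notation $k^2(1)$ means $(k(1))^2$. The intersection body $IK$ of $K$ is the origin-symmetric star body with radial function $\rho_{IK}(\xi)=\mathrm{Vol}_{n-1}(K\cap\xi^\perp)$, $\xi\in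 S^{n-1}$ (it is convex, by Busemann's theorem). The support function of a compact convex set $Z$ is $h_Z(x)=\sup\{\langle x,u\rangle:u\in Z\}$. A compact convex set $Z\subset\mathbb{R}^n$ is a zonoid (centered at the origin) if there is a finite non-negative even Borel measure $\mu$ on $S^{n-1}$ with $h_Z(u)=\int_{S^{n-1}}|\langle u,v\rangle|\,d\mu(v)$ for all $u\in S^{n-1}$. A convex body is a polar zonoid if it is the polar body of such a zonoid; equivalently (since $h_{L^*}=1/\rho_L$), an origin-symmetric convex body $L$ is a polar zonoid if its polar body $L^*=\{x:\langle x,y\rangle\le 1\ \forall y\in L\}$ is a zonoid. *)

theory Defs
  imports "HOL-Analysis.Analysis"
begin

definition convex_body :: "'a::euclidean_space set \<Rightarrow> bool" where
  "convex_body K \<longleftrightarrow> compact K \<and> convex K \<and> interior K \<noteq> {}"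

definition origin_symmetric :: "'a::real_vector set \<Rightarrow> bool" where
  "origin_symmetric K \<longleftrightarrow> (\<forall>x\<in>K. - x \<in> K)"

text \<open>For compact \<open>K\<close> containing \<open>0\<close> and \<open>\<xi> \<noteq> 0\<close> the supremum is attained, i.e. it is a maximum.\<close>

definition radial_fun :: "'a::real_vector set \<Rightarrow> 'a \<Rightarrow> real" where
  "radial_fun K \<xi> = Sup {l. 0 \<le> l \<and> l *\<^sub>R \<xi> \<in> K}"

text \<open>In the index type \<open>6\<close> the numeral \<open>6\<close> equals \<open>0\<close>; it is an index distinct from \<open>1, \<dots>, 5\<close>.\<close>

definition body_of_revolution :: "(real^6) set \<Rightarrow> bool" where
  "body_of_revolution K \<longleftrightarrow>
     (\<forall>Q :: real^6^6. rotation_matrix Q \<and> Q *v axis 6 1 = axis 6 1 \<longrightarrow> (\<lambda>x. Q *v x) ` K = K)"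

text \<open>The radial function of a body of revolution as a function of the cosine \<open>t\<close> of the angle with
  the axis. The unit vector orthogonal to the axis is fixed to be \<open>axis 1 1\<close>; by
  \<open>radial_profile_eq\<close> below the choice is irrelevant.\<close>

definition radial_profile :: "(real^6) set \<Rightarrow> real \<Rightarrow> real" where
  "radial_profile K t = radial_fun K (sqrt (1 - t\<^sup>2) *\<^sub>R axis 1 1 + t *\<^sub>R axis 6 1)"

lemma radial_fun_matrix_image:
  fixes Q :: "real^6^6"
  assumes Q: "rotation_matrix Q" and K: "(\<lambda>x. Q *v x) ` K = K"
  shows "radial_fun K (Q *v x) = radial_fun K x"
proof -
  have inv: "transpose Q *v (Q *v y) = y" for y
    using Q by (simp add: rotation_matrix_def orthogonal_matrix matrix_vector_mul_assoc)
  have "Q *v y \<in> K \<longleftrightarrow> y \<in> K" for y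
  proof
    assume "Q *v y \<in> K"
    then obtain z where "z \<in> K" "Q *v y = Q *v z" using K by blast
    then show "y \<in> K" by (metis inv)
  qed (use K in blast)
  then show ?thesis
    by (simp add: radial_fun_def flip: matrix_vector_mult_scaleR)
qed

lemma orthogonal_transformation_reflection:
  fixes v :: "'a::real_inner"
  shows "orthogonal_transformation (\<lambda>x. x - (2 * (x \<bullet> v) / (v \<bullet> v)) *\<^sub>R v)"
proof -
  have "linear (\<lambda>x. x - (2 * (x \<bullet> v) / (v \<bullet> v)) *\<^sub>R v)"
    by (rule linearI) (simp_all add: inner_add_left algebra_simps add_divide_distrib)
  moreover have "(x - (2 * (x \<bullet> v) / (v \<bullet> v)) *\<^sub>R v) \<bullet> (y - (2 * (y \<bullet> v) / (v \<bullet> v)) *\<^sub>R v) = x \<bullet> y" for x y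
    by (cases "v = 0") (simp_all add: inner_diff_left inner_diff_right inner_commute field_simps)
  ultimately show ?thesis by (simp add: orthogonal_transformation_def)
qed

lemma rotation_fixing_axis_exists:
  fixes \<xi> :: "real^6"
  assumes "norm \<xi> = 1" "\<xi> $ 6 = 0"
  obtains Q :: "real^6^6" where "rotation_matrix Q" "Q *v axis 6 1 = axis 6 1" "Q *v axis 1 1 = \<xi>"
proof -
  have ax16: "axis 1 1 \<bullet> (axis 6 1 :: real^6) = 0" "axis 2 1 \<bullet> (axis 6 1 :: real^6) = 0"
    "axis 1 1 \<bullet> (axis 2 1 :: real^6) = 0"
    by (simp_all add: inner_axis_axis)
  define R where "R = (\<lambda>v x :: real^6. x - (2 * (x \<bullet> v) / (v \<bullet> v)) *\<^sub>R v)"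
  have R: "orthogonal_transformation (R v)" for v
    unfolding R_def by (rule orthogonal_transformation_reflection)
  define f where "f = R (axis 1 1 - \<xi>)"
  have "axis 6 1 \<bullet> (axis 1 1 - \<xi>) = 0"
    using assms ax16(1) by (simp add: inner_diff_right inner_commute inner_axis)
  then have "f (axis 6 1) = axis 6 1"
    by (simp add: f_def R_def)
  moreover have f1: "f (axis 1 1) = \<xi>"
  proof (cases "\<xi> = axis 1 1")
    case False
    have 1: "\<xi> \<bullet> \<xi> = 1" using assms by (simp add: norm_eq_1)
    define v where "v = axis 1 1 - \<xi>"
    have "v \<bullet> v = 2 * (axis 1 1 \<bullet> v)"
      by (simp add: v_def inner_diff_left inner_diff_right 1 inner_commute inner_axis_axis)
    moreover have "v \<bullet> v \<noteq> 0" using False by (simp add: v_def)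
    ultimately have "2 * (axis 1 1 \<bullet> v) / (v \<bullet> v) = 1" by (metis divide_self)
    then have "f (axis 1 1) = axis 1 1 - v"
      unfolding f_def R_def v_def[symmetric] by (simp only: scaleR_one)
    then show ?thesis by (simp add: v_def)
  qed (simp add: f_def R_def)
  moreover have f: "orthogonal_transformation f" by (simp add: f_def R)
  moreover define g where "g = R (axis 2 1)"
  have g: "orthogonal_transformation g" by (simp add: g_def R)
  have "g (axis 6 1) = axis 6 1" "g (axis 1 1) = axis 1 1"
    by (simp_all add: g_def R_def ax16 inner_commute)
  moreover have detg: "det (matrix g) = -1"
  proof -
    have "g = (\<lambda>x. x - (2 * x $ 2) *\<^sub>R axis 2 1)"
      by (simp add: g_def R_def inner_axis_axis inner_axis)
    then have mg: "matrix g $ i $ j = (if i = j then (if i = 2 then -1 else 1) else 0)" for i j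
      by (auto simp: matrix_def axis_def)
    have "det (matrix g) = (\<Prod>i\<in>UNIV. matrix g $ i $ i)"
      by (rule det_diagonal) (simp add: mg)
    also have "\<dots> = -1" by (simp add: mg prod.delta)
    finally show ?thesis .
  qed
  ultimately have "(\<exists>h. orthogonal_transformation h \<and> det (matrix h) = 1 \<and>
     h (axis 6 1) = axis 6 1 \<and> h (axis 1 1) = \<xi>)"
  proof (cases "det (matrix f) = 1")
    case False
    then have "det (matrix f) = -1"
      using det_orthogonal_matrix[of "matrix f"] f by (auto simp: orthogonal_transformation_matrix)
    then have "det (matrix (f \<circ> g)) = 1"
      using f g detg by (simp add: matrix_compose det_mul orthogonal_transformation_linear)
    moreover have "orthogonal_transformation (f \<circ> g)"
      using f g by (simp add: orthogonal_transformation_compose)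
    ultimately show ?thesis
      using \<open>f (axis 6 1) = axis 6 1\<close> f1 \<open>g (axis 6 1) = axis 6 1\<close> \<open>g (axis 1 1) = axis 1 1\<close>
      by (intro exI[of _ "f \<circ> g"]) simp
  qed blast
  then obtain h where h: "orthogonal_transformation h" "det (matrix h) = 1"
     "h (axis 6 1) = axis 6 1" "h (axis 1 1) = \<xi>" by blast
  then have "matrix h *v x = h x" for x
    by (simp add: matrix_works orthogonal_transformation_linear)
  with h show ?thesis
    by (intro that[of "matrix h"]) (auto simp: rotation_matrix_def orthogonal_transformation_matrix)
qed

lemma radial_profile_eq:
  assumes "body_of_revolution K" "norm \<xi> = 1" "\<xi> $ 6 = 0"
  shows "radial_profile K t = radial_fun K (sqrt (1 - t\<^sup>2) *\<^sub>R \<xi> + t *\<^sub>R axis 6 1)"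
proof -
  obtain Q :: "real^6^6" where Q: "rotation_matrix Q" "Q *v axis 6 1 = axis 6 1" "Q *v axis 1 1 = \<xi>"
    using rotation_fixing_axis_exists assms(2,3) by blast
  have "(\<lambda>x. Q *v x) ` K = K"
    using assms(1) Q by (simp add: body_of_revolution_def)
  from radial_fun_matrix_image[OF Q(1) this, of "sqrt (1 - t\<^sup>2) *\<^sub>R axis 1 1 + t *\<^sub>R axis 6 1"]
  show ?thesis
    by (simp add: radial_profile_def matrix_vector_right_distrib matrix_vector_mult_scaleR Q)
qed

text \<open>Functions on \<open>[0,1]\<close> of class \<open>C\<^sup>2\<close> on a relative neighbourhood \<open>(1 - \<epsilon>, 1]\<close> of \<open>1\<close>;
  the derivatives at \<open>1\<close> are one-sided.\<close>

definition C2_near_1 :: "(real \<Rightarrow> real) \<Rightarrow> bool" where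
  "C2_near_1 f \<longleftrightarrow> (\<exists>\<epsilon>>0. \<epsilon> \<le> 1 \<and> (\<exists>f' f''.
     (\<forall>t\<in>{1 - \<epsilon><..1}. (f has_real_derivative f' t) (at t within {0..1}) \<and>
                      (f' has_real_derivative f'' t) (at t within {0..1})) \<and>
     continuous_on {1 - \<epsilon><..1} f''))"

definition isometric_param :: "(real^6) set \<Rightarrow> (real^5 \<Rightarrow> real^6) \<Rightarrow> bool" where
  "isometric_param H \<phi> \<longleftrightarrow> linear \<phi> \<and> (\<forall>y. norm (\<phi> y) = norm y) \<and> range \<phi> = H"

text \<open>The 5-dimensional volume of the part of \<open>A\<close> in a hyperplane \<open>H\<close> through the origin, computed
  in an isometric linear parametrization of \<open>H\<close>. The next two lemmas show that a parametrization
  exists and that the volume does not depend on it.\<close>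

definition section_volume :: "(real^6) set \<Rightarrow> (real^6) set \<Rightarrow> real" where
  "section_volume A H = measure lebesgue ((SOME \<phi>. isometric_param H \<phi>) -` A)"

lemma isometric_param_exists:
  assumes "\<xi> \<noteq> 0"
  shows "\<exists>\<phi>. isometric_param {x. \<xi> \<bullet> x = 0} \<phi>"
proof -
  have "dim (UNIV :: (real^5) set) = dim {x. \<xi> \<bullet> x = 0}"
    using assms by (simp add: dim_hyperplane)
  then obtain \<phi> :: "real^5 \<Rightarrow> real^6" where "linear \<phi>" "range \<phi> = {x. \<xi> \<bullet> x = 0}"
     "\<And>x. x \<in> UNIV \<Longrightarrow> norm (\<phi> x) = norm x"
    using isometry_subspaces[OF subspace_UNIV subspace_hyperplane] by metis
  then show ?thesis by (auto simp: isometric_param_def)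
qed

lemma section_volume_eq:
  assumes \<phi>: "isometric_param H \<phi>" and A: "compact A"
  shows "section_volume A H = measure lebesgue (\<phi> -` A)"
proof -
  define \<psi> where "\<psi> = (SOME \<phi>. isometric_param H \<phi>)"
  have \<psi>: "isometric_param H \<psi>" unfolding \<psi>_def by (rule someI[of "isometric_param H", OF \<phi>])
  have inj: "inj \<theta>" if "isometric_param H \<theta>" for \<theta>
    using that unfolding isometric_param_def by (metis linear_injective_0 norm_eq_zero)
  define T where "T = inv \<phi> \<circ> \<psi>"
  have \<phi>T: "\<phi> (T y) = \<psi> y" for y
    using \<phi> \<psi> unfolding T_def isometric_param_def by (metis comp_apply f_inv_into_f rangeI)
  have lin: "linear \<phi>" "linear \<psi>" using \<phi> \<psi> by (auto simp: isometric_param_def)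
  have "linear T"
    by (intro linearI injD[OF inj[OF \<phi>]])
       (simp_all add: \<phi>T linear_add[OF lin(1)] linear_scale[OF lin(1)]
         linear_add[OF lin(2)] linear_scale[OF lin(2)])
  moreover have "norm (T y) = norm y" for y
    using \<phi> \<psi> \<phi>T by (metis isometric_param_def)
  ultimately have T: "orthogonal_transformation T" by (simp add: orthogonal_transformation)
  have "surj T" using T by (rule orthogonal_transformation_surj)
  have "T ` (\<psi> -` A) = \<phi> -` A"
  proof safe
    fix y assume "\<phi> y \<in> A"
    moreover obtain z where "y = T z" using \<open>surj T\<close> by blast
    ultimately show "y \<in> T ` (\<psi> -` A)" by (simp add: \<phi>T)
  qed (simp add: \<phi>T)
  moreover have "compact (\<psi> -` A)"
  proof -
    obtain B where B: "\<And>x. x \<in> A \<Longrightarrow> norm x \<le> B"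
      using A compact_imp_bounded bounded_iff by metis
    have "bounded (\<psi> -` A)"
      unfolding bounded_iff using B \<psi> by (metis isometric_param_def vimage_eq)
    moreover have "closed (\<psi> -` A)"
      using A lin(2) by (intro closed_vimage compact_imp_closed linear_continuous_on linear_linear[THEN iffD1])
        (auto simp: linear_linear linear_continuous_on)
    ultimately show ?thesis by (simp add: compact_eq_bounded_closed)
  qed
  then have "\<psi> -` A \<in> lmeasurable" by (rule lmeasurable_compact)
  ultimately have "measure lebesgue (\<phi> -` A) = measure lebesgue (\<psi> -` A)"
    using measure_orthogonal_image[OF T] by metis
  then show ?thesis by (simp add: section_volume_def \<psi>_def)
qed

definition intersection_body :: "(real^6) set \<Rightarrow> (real^6) set" where
  "intersection_body K =
     {l *\<^sub>R \<xi> |l \<xi>. norm \<xi> = 1 \<and> 0 \<le> l \<and> l \<le> section_volume K {x. \<xi> \<bullet> x = 0}}"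

lemma radial_fun_intersection_body:
  assumes \<xi>: "norm \<xi> = 1"
  shows "radial_fun (intersection_body K) \<xi> = section_volume K {x. \<xi> \<bullet> x = 0}"
proof -
  let ?V = "\<lambda>\<xi>. section_volume K {x. \<xi> \<bullet> x = 0}"
  have V: "0 \<le> ?V \<zeta>" for \<zeta> by (simp add: section_volume_def)
  have "{l. 0 \<le> l \<and> l *\<^sub>R \<xi> \<in> intersection_body K} = {0..?V \<xi>}"
  proof safe
    fix l assume l: "0 \<le> l" "l *\<^sub>R \<xi> \<in> intersection_body K"
    then obtain m \<zeta> where m: "l *\<^sub>R \<xi> = m *\<^sub>R \<zeta>" "norm \<zeta> = 1" "0 \<le> m" "m \<le> ?V \<zeta>"
      by (auto simp: intersection_body_def)
    then have "l = m" using \<xi> l(1) by (metis abs_of_nonneg mult.right_neutral norm_scaleR)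
    then show "l \<in> {0..?V \<xi>}" using m l V by (cases "l = 0") auto
  qed (use \<xi> in \<open>auto simp: intersection_body_def\<close>)
  then show ?thesis by (simp add: radial_fun_def V)
qed

definition support_fun :: "'a::real_inner set \<Rightarrow> 'a \<Rightarrow> real" where
  "support_fun Z x = (SUP u\<in>Z. x \<bullet> u)"

definition polar_body :: "'a::real_inner set \<Rightarrow> 'a set" where
  "polar_body L = {x. \<forall>y\<in>L. x \<bullet> y \<le> 1}"

text \<open>\<open>Z\<close> is required to be nonempty because \<open>Sup {}\<close> is an unspecified real number.\<close>

definition zonoid :: "'a::euclidean_space set \<Rightarrow> bool" where
  "zonoid Z \<longleftrightarrow> compact Z \<and> convex Z \<and> Z \<noteq> {} \<and>
     (\<exists>\<mu> :: 'a measure. sets \<mu> = sets (restrict_space borel (sphere 0 1)) \<and> finite_measure \<mu> \<and>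
        (\<forall>A\<in>sets \<mu>. emeasure \<mu> (uminus ` A) = emeasure \<mu> A) \<and>
        (\<forall>u\<in>sphere 0 1. support_fun Z u = (\<integral>v. \<bar>u \<bullet> v\<bar> \<partial>\<mu>)))"

text \<open>That \<open>L\<close> is a convex body is not required separately: the polar of a bounded set is closed and
  convex and contains a ball around \<open>0\<close>, so for bounded \<open>L\<close> it is automatic.\<close>

definition polar_zonoid :: "'a::euclidean_space set \<Rightarrow> bool" where
  "polar_zonoid L \<longleftrightarrow> (\<exists>Z. zonoid Z \<and> L = polar_body Z)"

definition r_fun :: "(real^6) set \<Rightarrow> real \<Rightarrow> real" where
  "r_fun K t = radial_profile K t ^ 5"

definition h_fun :: "(real^6) set \<Rightarrow> real \<Rightarrow> real" where
  "h_fun K x = integral {0..x} (\<lambda>t. radial_profile K t ^ 5 * (x\<^sup>2 - t\<^sup>2))"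

definition k_one :: "(real^6) set \<Rightarrow> real" where
  "k_one K = integral {0..1} (\<lambda>t. t\<^sup>2 * radial_profile K t ^ 5)"

end

theory Submission
  imports Defs
begin

text \<open>
  The volume of the section of \<open>K\<close> by the hyperplane orthogonal to \<open>e + z e\<^sub>6\<close> (\<open>e\<close> a unit vector on the
  equator) is a constant multiple of \<open>P x / x\<close>, where \<open>x = 1 / sqrt (1 + z\<^sup>2)\<close> and \<open>P x = h x / x\<^sup>2\<close>.
  If \<open>IK\<close> is the polar of a zonoid \<open>Z\<close>, then \<open>g z = h\<^sub>Z (e + z e\<^sub>6)\<close> is a constant multiple of \<open>1 / P x\<close>.
  Averaging the zonoid representation of \<open>h\<^sub>Z\<close> over the equator \<open>S\<^sup>4\<close>, whose one-dimensional marginal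
  has density proportional to \<open>1 - a\<^sup>2\<close>, writes \<open>g z\<close> as a positive superposition of the functions
  \<open>\<integral> (1 - a\<^sup>2) \<bar>a \<alpha> + z \<beta>\<bar> da\<close>. Their second derivatives in \<open>z\<close> are multiples of the positive part of
  \<open>1 - z\<^sup>2 (\<beta>/\<alpha>)\<^sup>2\<close>, so the second derivative of \<open>g\<close> is a convex function of \<open>y = z\<^sup>2\<close>.

  On the other hand, \<open>P\<close> as a function of \<open>y\<close> has the derivatives \<open>- k x\<close> and \<open>x\<^sup>5 r x / 2\<close>, and its third
  derivative tends at \<open>y = 0\<close> to a multiple of \<open>5 r(1) + r'(1)\<close>, which vanishes because
  \<open>\<rho>(1) + \<rho>'(1) = 0\<close>. Hence the third derivative \<open>\<Phi>\<^sub>3\<close> of \<open>\<Phi> = 1 / P\<close> tends to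
  \<open>3 k(1) (2 k(1)\<^sup>2 - h(1) r(1)) / h(1)\<^sup>4 < 0\<close>. The second derivative of \<open>g\<close> is a multiple of
  \<open>2 \<Phi>\<^sub>1 + 4 y \<Phi>\<^sub>2\<close>, whose derivative \<open>6 \<Phi>\<^sub>2 + 4 y \<Phi>\<^sub>3\<close> therefore drops below its limit at \<open>y = 0\<close>,
  contradicting convexity.
\<close>

section \<open>Zonal integrals\<close>

lemma lborel_distr_orthogonal_transformation:
  fixes T :: "real^'n::{finite,wellorder} \<Rightarrow> real^'n::_"
  assumes T: "orthogonal_transformation T"
  shows "distr lborel borel T = lborel"
proof (rule lborel_eqI[symmetric])
  have T_meas: "T \<in> borel_measurable borel"
    using T by (simp add: borel_measurable_continuous_onI linear_continuous_on
      orthogonal_transformation_linear linear_linear)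
  fix l u :: "real^'n::{finite,wellorder}"
  assume "\<And>b. b \<in> Basis \<Longrightarrow> l \<bullet> b \<le> u \<bullet> b"
  have inv: "orthogonal_transformation (inv T)"
    using T by (rule orthogonal_transformation_inv)
  have eq: "T -` box l u = inv T ` box l u"
    using orthogonal_transformation_bij[OF T] by (simp add: bij_vimage_eq_inv_image)
  have "inv T ` box l u \<in> lmeasurable"
    by (rule measurable_orthogonal_image[OF inv lmeasurable_box])
  then have "emeasure lebesgue (inv T ` box l u) = measure lebesgue (inv T ` box l u)"
    by (simp add: emeasure_eq_measure2)
  also have "\<dots> = measure lebesgue (box l u)"
    by (simp add: measure_orthogonal_image[OF inv lmeasurable_box])
  also have "\<dots> = emeasure lebesgue (box l u)"
    by (simp add: emeasure_eq_measure2)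
  finally have "emeasure lborel (T -` box l u) = emeasure lborel (box l u)"
    using measurable_sets[OF T_meas, of "box l u"]
    by (simp add: eq emeasure_lborel_box_eq)
  then show "emeasure (distr lborel borel T) (box l u) = (\<Prod>b\<in>Basis. (u - l) \<bullet> b)"
    using \<open>\<And>b. b \<in> Basis \<Longrightarrow> l \<bullet> b \<le> u \<bullet> b\<close> T_meas
    by (simp add: emeasure_distr)
qed simp

text \<open>Relabelling coordinates along a bijection of the bases pulls boxes back to boxes with
  the same side lengths, and \<open>lborel\<close> is determined by its values on boxes. This links
  spaces of different type but equal dimension.\<close>

lemma lborel_distr_basis_bij:
  fixes \<pi> :: "'b::euclidean_space \<Rightarrow> 'a::euclidean_space"
  assumes \<pi>: "bij_betw \<pi> Basis Basis"
  shows "distr lborel borel (\<lambda>x. \<Sum>b\<in>Basis. (x \<bullet> \<pi> b) *\<^sub>R b) = lborel"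
proof (rule lborel_eqI[symmetric])
  let ?f = "\<lambda>x. \<Sum>b\<in>Basis. (x \<bullet> \<pi> b) *\<^sub>R b"
  fix l u :: 'b
  assume le: "\<And>b. b \<in> Basis \<Longrightarrow> l \<bullet> b \<le> u \<bullet> b"
  define \<sigma> where "\<sigma> = inv_into Basis \<pi>"
  have \<sigma>: "\<sigma> a \<in> Basis" "\<pi> (\<sigma> a) = a" if "a \<in> Basis" for a
    using that \<pi> unfolding \<sigma>_def bij_betw_def by (metis inv_into_into, metis f_inv_into_f)
  have \<sigma>\<pi>: "\<sigma> (\<pi> b) = b" "\<pi> b \<in> Basis" if "b \<in> Basis" for b
    using that \<pi> unfolding \<sigma>_def by (auto simp: bij_betw_def)
  define l' u' where "l' = (\<Sum>a\<in>Basis. (l \<bullet> \<sigma> a) *\<^sub>R a)" and "u' = (\<Sum>a\<in>Basis. (u \<bullet> \<sigma> a) *\<^sub>R a)"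
  have l': "l' \<bullet> a = l \<bullet> \<sigma> a" "u' \<bullet> a = u \<bullet> \<sigma> a" if "a \<in> Basis" for a
    using that by (simp_all add: l'_def u'_def)
  have eq: "?f -` box l u = box l' u'"
  proof (intro set_eqI iffI)
    fix x assume "x \<in> ?f -` box l u"
    then have "l \<bullet> b < x \<bullet> \<pi> b \<and> x \<bullet> \<pi> b < u \<bullet> b" if "b \<in> Basis" for b
      using that by (simp add: mem_box)
    then show "x \<in> box l' u'" using \<sigma> by (auto simp: mem_box l') (metis, metis)
  next
    fix x assume "x \<in> box l' u'"
    then show "x \<in> ?f -` box l u" using \<sigma>\<pi> by (force simp: mem_box l')
  qed
  have "emeasure (distr lborel borel ?f) (box l u) = emeasure lborel (box l' u')"
    by (subst emeasure_distr) (simp_all add: eq)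
  also have "\<dots> = (\<Prod>a\<in>Basis. (u' - l') \<bullet> a)"
    by (rule emeasure_lborel_box) (simp add: l' le \<sigma>)
  also have "(\<Prod>a\<in>Basis. (u' - l') \<bullet> a) = (\<Prod>b\<in>Basis. (u' - l') \<bullet> \<pi> b)"
    using prod.reindex_bij_betw[OF \<pi>] by metis
  also have "\<dots> = (\<Prod>b\<in>Basis. (u - l) \<bullet> b)"
    by (intro prod.cong) (simp_all add: l' \<sigma>\<pi> inner_diff_left)
  finally show "emeasure (distr lborel borel ?f) (box l u) = (\<Prod>b\<in>Basis. (u - l) \<bullet> b)" .
qed simp

text \<open>The domain is a general Euclidean space because the isometry needed later starts from
  the product of \<open>real^4\<close> and \<open>real\<close>. It factors into the relabelling
  \<open>f\<^sub>0\<close> followed by the orthogonal transformation \<open>f \<circ> e\<close>, and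
  both preserve \<open>lborel\<close>.\<close>

lemma lborel_distr_linear_isometry:
  fixes f :: "'a::euclidean_space \<Rightarrow> real^'n::{finite,wellorder}"
  assumes f: "linear f" "\<And>x. norm (f x) = norm x" and dim: "DIM('a) = CARD('n)"
  shows "distr lborel borel f = lborel"
proof -
  obtain \<pi> :: "real^'n::{finite,wellorder} \<Rightarrow> 'a" where \<pi>: "bij_betw \<pi> Basis Basis"
    using finite_same_card_bij[of "Basis :: (real^'n::{finite,wellorder}) set" "Basis :: 'a set"] dim by auto
  define e where "e = (\<lambda>x :: real^'n::{finite,wellorder}. \<Sum>b\<in>Basis. (x \<bullet> b) *\<^sub>R \<pi> b)"
  define f\<^sub>0 where "f\<^sub>0 = (\<lambda>x :: 'a. \<Sum>b\<in>Basis. (x \<bullet> \<pi> b) *\<^sub>R (b :: real^'n::{finite,wellorder}))"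
  have "linear e"
    by (rule linearI) (simp_all add: e_def inner_add_left sum.distrib scaleR_sum_right scaleR_add_left)
  have "linear f\<^sub>0"
    by (rule linearI) (simp_all add: f\<^sub>0_def inner_add_left sum.distrib scaleR_sum_right scaleR_add_left)
  have e\<pi>: "e x \<bullet> \<pi> b = x \<bullet> b" if "b \<in> Basis" for x b
  proof -
    have "e x \<bullet> \<pi> b = (\<Sum>c\<in>Basis. (x \<bullet> c) * (if c = b then 1 else 0))"
      unfolding e_def inner_sum_left inner_scaleR_left
    proof (rule sum.cong[OF refl])
      fix c :: "real^'n::{finite,wellorder}" assume "c \<in> Basis"
      then have "\<pi> c \<in> Basis" "\<pi> b \<in> Basis" "\<pi> c = \<pi> b \<longleftrightarrow> c = b"
        using that \<pi> by (auto simp: bij_betw_def inj_on_def)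
      then show "(x \<bullet> c) * (\<pi> c \<bullet> \<pi> b) = (x \<bullet> c) * (if c = b then 1 else 0)"
        by (simp add: inner_Basis)
    qed
    then show ?thesis using that by (simp add: sum.delta if_distrib cong: if_cong)
  qed
  have "norm (e x) = norm x" for x
  proof -
    have "e x \<bullet> e x = (\<Sum>a\<in>Basis. (e x \<bullet> a)\<^sup>2)" using euclidean_inner[of "e x" "e x"] by (simp only: power2_eq_square)
    also have "\<dots> = (\<Sum>b\<in>Basis. (e x \<bullet> \<pi> b)\<^sup>2)" using sum.reindex_bij_betw[OF \<pi>, of "\<lambda>a. (e x \<bullet> a)\<^sup>2"] by (rule sym)
    also have "\<dots> = x \<bullet> x" using euclidean_inner[of x x] by (simp add: e\<pi> power2_eq_square)
    finally show ?thesis by (simp add: norm_eq_sqrt_inner)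
  qed
  then have T: "orthogonal_transformation (f \<circ> e)"
    using f \<open>linear e\<close> by (simp add: orthogonal_transformation linear_compose)
  have "e (f\<^sub>0 x) = x" for x
  proof -
    have "e (f\<^sub>0 x) = (\<Sum>b\<in>Basis. (x \<bullet> \<pi> b) *\<^sub>R \<pi> b)" by (simp add: e_def f\<^sub>0_def)
    also have "\<dots> = (\<Sum>a\<in>Basis. (x \<bullet> a) *\<^sub>R a)"
      using sum.reindex_bij_betw[OF \<pi>, of "\<lambda>a. (x \<bullet> a) *\<^sub>R a"] by simp
    finally show ?thesis by (simp add: euclidean_representation)
  qed
  then have "f = (f \<circ> e) \<circ> f\<^sub>0" by auto
  then have "distr lborel borel f = distr (distr lborel borel f\<^sub>0) borel (f \<circ> e)"
    using \<open>linear f\<^sub>0\<close> orthogonal_transformation_linear[OF T]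
    by (subst distr_distr) (auto intro!: borel_measurable_continuous_onI linear_continuous_on simp: linear_linear)
  then show ?thesis
    using lborel_distr_basis_bij[OF \<pi>] lborel_distr_orthogonal_transformation[OF T]
    by (simp add: f\<^sub>0_def)
qed

section \<open>Integration of functions of the angle with a fixed direction\<close>

lemma borel_measurable_norm_cball [measurable]:
  "(\<lambda>y::'a::euclidean_space. ennreal (norm y) * indicator (cball 0 c) y) \<in> borel_measurable borel"
  by (intro borel_measurable_times_ennreal borel_measurable_indicator) (simp_all add: borel_closed)

text \<open>Substituting \<open>c *\<^sub>R y\<close> for \<open>y\<close> produces
  \<open>c ^ DIM('a)\<close> from the volume and one further factor \<open>c\<close> from the
  norm.\<close>

lemma nn_integral_norm_cball:
  assumes "0 \<le> c"
  shows "(\<integral>\<^sup>+y. ennreal (norm y) * indicator (cball 0 c) (y::'a::euclidean_space) \<partial>lborel) =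
    ennreal (c ^ (DIM('a) + 1)) * (\<integral>\<^sup>+y. ennreal (norm y) * indicator (cball 0 1) (y::'a) \<partial>lborel)"
proof (cases "c = 0")
  case True
  then have "ennreal (norm y) * indicator (cball 0 c) y = 0" for y :: 'a
    by (simp add: indicator_def)
  with True show ?thesis by simp
next
  case False
  with assms have c: "0 < c" by simp
  have "(\<integral>\<^sup>+y. ennreal (norm y) * indicator (cball 0 c) (y::'a) \<partial>lborel) =
     (\<integral>\<^sup>+y. ennreal (c ^ DIM('a)) * (ennreal (norm (c *\<^sub>R y)) * indicator (cball 0 c) (c *\<^sub>R (y::'a))) \<partial>lborel)"
  proof -
    have "(\<integral>\<^sup>+y. ennreal (norm y) * indicator (cball 0 c) (y::'a) \<partial>lborel) =
      (\<integral>\<^sup>+y. ennreal (norm y) * indicator (cball 0 c) y \<partial>density (distr lborel borel (\<lambda>y::'a. 0 + c *\<^sub>R y)) (\<lambda>_. ennreal (\<bar>c\<bar> ^ DIM('a))))"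
      using c lborel_affine[of c "0::'a"] by simp
    also have "\<dots> = (\<integral>\<^sup>+y. ennreal (\<bar>c\<bar> ^ DIM('a)) * (ennreal (norm y) * indicator (cball 0 c) y) \<partial>distr lborel borel (\<lambda>y::'a. 0 + c *\<^sub>R y))"
      by (rule nn_integral_density) simp_all
    also have "\<dots> = (\<integral>\<^sup>+y. ennreal (\<bar>c\<bar> ^ DIM('a)) * (ennreal (norm (0 + c *\<^sub>R y)) * indicator (cball 0 c) (0 + c *\<^sub>R y)) \<partial>(lborel :: 'a measure))"
      by (rule nn_integral_distr) simp_all
    finally show ?thesis using c by simp
  qed
  also have "\<dots> = (\<integral>\<^sup>+y. ennreal (c ^ (DIM('a) + 1)) * (ennreal (norm y) * indicator (cball 0 1) (y::'a)) \<partial>lborel)"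
    using c by (intro nn_integral_cong) (auto simp: indicator_def ennreal_mult[symmetric] mult_ac)
  finally show ?thesis by (simp add: nn_integral_cmult)
qed

text \<open>This changes variables from the cotangent \<open>q\<close> of an angle to its cosine,
  which maps the line increasingly onto the open interval from -1 to 1. The substitution rule is
  applied on compact intervals, and continuity of measures along increasing sets gives the whole
  line.\<close>

lemma nn_integral_substitution_tangent:
  fixes f :: "real \<Rightarrow> ennreal"
  assumes [measurable]: "f \<in> borel_measurable borel"
  shows "(\<integral>\<^sup>+q. f (q / sqrt (1 + q\<^sup>2)) * ennreal (1 / sqrt (1 + q\<^sup>2) ^ 3) \<partial>lborel) =
    (\<integral>\<^sup>+t. f t * indicator {-1<..<1} t \<partial>lborel)"
proof -
  define g where "g = (\<lambda>q::real. q / sqrt (1 + q\<^sup>2))"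
  define g' where "g' = (\<lambda>q::real. 1 / sqrt (1 + q\<^sup>2) ^ 3)"
  have pos: "0 < 1 + q\<^sup>2" for q :: real by (simp add: add_pos_nonneg)
  have [measurable]: "g \<in> borel_measurable borel" "g' \<in> borel_measurable borel"
    by (simp_all add: g_def g'_def)
  have g'_pos: "0 < g' q" for q using pos by (simp add: g'_def)
  have deriv: "(g has_real_derivative g' q) (at q)" for q
  proof -
    have s: "sqrt (1 + q\<^sup>2) * sqrt (1 + q\<^sup>2) = 1 + q\<^sup>2" "sqrt (1 + q\<^sup>2) \<noteq> 0"
      using pos[of q] by auto
    have "(g has_real_derivative (sqrt (1 + q\<^sup>2) - q * (q / sqrt (1 + q\<^sup>2))) / (sqrt (1 + q\<^sup>2) * sqrt (1 + q\<^sup>2))) (at q)"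
      unfolding g_def using pos[of q] by (auto intro!: derivative_eq_intros simp: field_simps)
    also have "(sqrt (1 + q\<^sup>2) - q * (q / sqrt (1 + q\<^sup>2))) / (sqrt (1 + q\<^sup>2) * sqrt (1 + q\<^sup>2)) = g' q"
    proof -
      have "sqrt (1 + q\<^sup>2) - q * (q / sqrt (1 + q\<^sup>2)) = 1 / sqrt (1 + q\<^sup>2)"
        using s by (simp add: field_simps power2_eq_square)
      then show ?thesis by (simp add: g'_def power3_eq_cube)
    qed
    finally show ?thesis .
  qed
  have g'_cont: "continuous_on S g'" for S
    unfolding g'_def using pos by (intro continuous_intros) (auto simp: less_imp_neq[OF pos, symmetric])
  have mono: "g a \<le> g b" if "a \<le> b" for a b
    using DERIV_nonneg_imp_nondecreasing[OF that] deriv g'_pos less_imp_le by metis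
  have bound: "\<bar>g q\<bar> < 1" for q
  proof -
    have "\<bar>q\<bar> < sqrt (1 + q\<^sup>2)" by (rule real_less_rsqrt) simp
    then show ?thesis using pos[of q] by (simp add: g_def abs_divide)
  qed
  have inv: "g (t / sqrt (1 - t\<^sup>2)) = t" if "\<bar>t\<bar> < 1" for t
  proof -
    have "t\<^sup>2 < 1" using that by (simp add: abs_square_less_1)
    then have "1 + (t / sqrt (1 - t\<^sup>2))\<^sup>2 = 1 / (1 - t\<^sup>2)" by (simp add: power_divide field_simps)
    with \<open>t\<^sup>2 < 1\<close> show ?thesis by (simp add: g_def real_sqrt_divide)
  qed
  \<comment> \<open>The successor keeps every interval nondegenerate, so that the substitution rule
    for intervals applies to each of them.\<close>
  define A where "A n = {- real (Suc n)..real (Suc n)}" for n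
  define B where "B n = {g (- real (Suc n))..g (real (Suc n))}" for n
  have "incseq A" by (auto simp: incseq_def A_def)
  have "incseq B" unfolding incseq_def B_def using mono by (auto intro: order_trans)
  have UA: "(\<Union>n. A n) = UNIV"
  proof -
    have "\<exists>n. x \<in> A n" for x
    proof -
      obtain n where "\<bar>x\<bar> \<le> real n" using real_arch_simple by blast
      then show ?thesis by (intro exI[of _ n]) (auto simp: A_def)
    qed
    then show ?thesis by blast
  qed
  have UB: "(\<Union>n. B n) = {-1<..<1}"
  proof (intro set_eqI iffI)
    fix t assume "t \<in> (\<Union>n. B n)"
    then show "t \<in> {-1<..<1}" unfolding B_def
      using bound by (auto simp: abs_less_iff) (metis minus_less_iff order_less_le_trans, metis order_le_less_trans)
  next
    fix t :: real assume "t \<in> {-1<..<1}"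
    then have t: "g (t / sqrt (1 - t\<^sup>2)) = t" by (intro inv) auto
    obtain n where "t / sqrt (1 - t\<^sup>2) \<in> A n" using UA by blast
    then have "t \<in> B n" using mono t by (metis A_def B_def atLeastAtMost_iff)
    then show "t \<in> (\<Union>n. B n)" by blast
  qed
  have eq: "emeasure (density lborel (\<lambda>q. f (g q) * ennreal (g' q))) (A n) = emeasure (density lborel f) (B n)" for n
  proof -
    have "(\<integral>\<^sup>+x. f x * indicator {g (- real (Suc n))..g (real (Suc n))} x \<partial>lborel) =
      (\<integral>\<^sup>+x. f (g x) * g' x * indicator {- real (Suc n)..real (Suc n)} x \<partial>lborel)"
      by (rule nn_integral_substitution_aux)
        (auto intro!: deriv less_imp_le[OF g'_pos] g'_cont)
    then show ?thesis by (simp add: emeasure_density A_def B_def)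
  qed
  have "emeasure (density lborel (\<lambda>q. f (g q) * ennreal (g' q))) UNIV = emeasure (density lborel f) {-1<..<1}"
  proof -
    have "range A \<subseteq> sets lborel" "range B \<subseteq> sets lborel" by (auto simp: A_def B_def)
    then have "(SUP n. emeasure (density lborel (\<lambda>q. f (g q) * ennreal (g' q))) (A n)) = emeasure (density lborel (\<lambda>q. f (g q) * ennreal (g' q))) UNIV"
      "(SUP n. emeasure (density lborel f) (B n)) = emeasure (density lborel f) {-1<..<1}"
      using SUP_emeasure_incseq[of A "density lborel (\<lambda>q. f (g q) * ennreal (g' q))"] SUP_emeasure_incseq[of B "density lborel f"]
        \<open>incseq A\<close> \<open>incseq B\<close> by (simp_all only: UA UB sets_density)
    then show ?thesis by (simp add: eq)
  qed
  then show ?thesis by (simp add: emeasure_density g_def g'_def)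
qed

text \<open>This takes the place of polar coordinates in \<open>real^5\<close>: up to a constant,
  \<open>1 - t\<^sup>2\<close> is the density of a coordinate on the unit sphere, and radial
  integration contributes \<open>\<rho> t ^ 5\<close>. The proof writes \<open>Y\<close> as
  \<open>\<theta> y + s *\<^sub>R p\<close> and reduces to integrals of \<open>norm y\<close> over
  balls in \<open>real^4\<close>. It serves both for section volumes (\<open>f\<close> constant 1)
  and for averages over the equator (\<open>\<rho>\<close> constant 1).\<close>

lemma nn_integral_zonal:
  fixes p :: "real^5" and f :: "real \<Rightarrow> ennreal" and \<rho> :: "real \<Rightarrow> real"
  assumes p: "norm p = 1"
    and f [measurable]: "f \<in> borel_measurable borel"
    and \<rho> [measurable]: "\<rho> \<in> borel_measurable borel" and \<rho>_nonneg: "\<And>t. 0 \<le> \<rho> t"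
  shows "(\<integral>\<^sup>+Y. f (Y \<bullet> p / norm Y) * indicator {Y. norm Y \<le> \<rho> (Y \<bullet> p / norm Y)} Y \<partial>lborel) =
    (\<integral>\<^sup>+y. ennreal (norm y) * indicator (cball 0 1) (y::real^4) \<partial>lborel) *
    (\<integral>\<^sup>+t. f t * ennreal ((1 - t\<^sup>2) * \<rho> t ^ 5) * indicator {-1<..<1} t \<partial>lborel)"
    (is "_ = ?\<kappa> * _")
proof -
  have "dim (UNIV :: (real^4) set) = dim {x. p \<bullet> x = 0}"
    using p by (subst dim_hyperplane) auto
  then obtain \<theta> :: "real^4 \<Rightarrow> real^5" where \<theta>: "linear \<theta>" "range \<theta> = {x. p \<bullet> x = 0}" "\<And>x. norm (\<theta> x) = norm x"
    using isometry_subspaces[OF subspace_UNIV subspace_hyperplane] by (metis UNIV_I)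
  define F where "F = (\<lambda>(y, s). \<theta> y + s *\<^sub>R p)"
  have pp: "p \<bullet> p = 1" using p by (simp add: norm_eq_1)
  have \<theta>p: "\<theta> y \<bullet> p = 0" for y using \<theta>(2) by (force simp: inner_commute)
  have Fp: "F (y, s) \<bullet> p = s" for y s by (simp add: F_def inner_add_left \<theta>p pp)
  have nF: "norm (F (y, s)) = sqrt ((norm y)\<^sup>2 + s\<^sup>2)" for y s
  proof -
    have "F (y, s) \<bullet> F (y, s) = \<theta> y \<bullet> \<theta> y + s\<^sup>2"
      by (simp add: F_def inner_add_left inner_add_right \<theta>p pp inner_commute[of p "\<theta> y"] power2_eq_square)
    also have "\<theta> y \<bullet> \<theta> y = (norm y)\<^sup>2" by (simp add: dot_square_norm \<theta>(3))
    finally show ?thesis by (simp only: norm_eq_sqrt_inner[of "F (y, s)"])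
  qed
  have "linear F" unfolding F_def
    by (rule linearI) (auto simp: linear_add[OF \<theta>(1)] linear_scale[OF \<theta>(1)] algebra_simps)
  then have [measurable]: "F \<in> borel_measurable borel"
    by (intro borel_measurable_continuous_onI linear_continuous_on) (simp add: linear_linear)
  have distr: "distr lborel borel F = lborel"
    using \<open>linear F\<close> by (rule lborel_distr_linear_isometry) (auto simp: nF norm_prod_def)
  define G where "G = (\<lambda>Y. f (Y \<bullet> p / norm Y) * indicator {Y. norm Y \<le> \<rho> (Y \<bullet> p / norm Y)} Y)"
  have [measurable]: "G \<in> borel_measurable borel" unfolding G_def by measurable
  define \<tau> where "\<tau> q = q / sqrt (1 + q\<^sup>2)" for q :: real
  define c where "c q = \<rho> (\<tau> q) / sqrt (1 + q\<^sup>2)" for q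
  have [measurable]: "\<tau> \<in> borel_measurable borel" "c \<in> borel_measurable borel"
    unfolding \<tau>_def[abs_def] c_def[abs_def] by measurable
  have pos: "0 < 1 + q\<^sup>2" for q :: real by (simp add: add_pos_nonneg)
  have c_nonneg: "0 \<le> c q" for q by (simp add: c_def \<rho>_nonneg)
  \<comment> \<open>On each fibre substitute \<open>s = norm y * q\<close>: the cosine \<open>\<tau> q\<close> then no longer depends on \<open>y\<close>.\<close>
  have slice: "(\<integral>\<^sup>+s. G (F (y, s)) \<partial>lborel) = (\<integral>\<^sup>+q. f (\<tau> q) * (ennreal (norm y) * indicator (cball 0 (c q)) y) \<partial>lborel)"
    if "y \<noteq> 0" for y
  proof -
    have y: "0 < norm y" using that by simp
    have "(\<integral>\<^sup>+s. G (F (y, s)) \<partial>lborel) = (\<integral>\<^sup>+q. ennreal (norm y) * G (F (y, norm y * q)) \<partial>lborel)"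
      using y by (subst nn_integral_real_affine[of _ "norm y" 0]) (auto simp: nn_integral_cmult)
    also have "\<dots> = (\<integral>\<^sup>+q. f (\<tau> q) * (ennreal (norm y) * indicator (cball 0 (c q)) y) \<partial>lborel)"
    proof (intro nn_integral_cong)
      fix q
      have "sqrt ((norm y)\<^sup>2 + (norm y * q)\<^sup>2) = sqrt ((norm y)\<^sup>2 * (1 + q\<^sup>2))"
        by (simp add: power_mult_distrib algebra_simps)
      then have n: "norm (F (y, norm y * q)) = norm y * sqrt (1 + q\<^sup>2)"
        by (simp add: nF real_sqrt_mult)
      then have "F (y, norm y * q) \<bullet> p / norm (F (y, norm y * q)) = \<tau> q"
        using y by (simp add: Fp \<tau>_def)
      then show "ennreal (norm y) * G (F (y, norm y * q)) = f (\<tau> q) * (ennreal (norm y) * indicator (cball 0 (c q)) y)"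
        using pos[of q] by (simp add: G_def n c_def pos_le_divide_eq indicator_def mult.left_commute)
    qed
    finally show ?thesis .
  qed
  have "(\<integral>\<^sup>+Y. G Y \<partial>lborel) = (\<integral>\<^sup>+z. G (F z) \<partial>lborel)"
    by (subst distr[symmetric], subst nn_integral_distr) auto
  also have "\<dots> = (\<integral>\<^sup>+z. G (F z) \<partial>(lborel \<Otimes>\<^sub>M lborel))"
    by (simp add: lborel_prod)
  also have "\<dots> = (\<integral>\<^sup>+y. \<integral>\<^sup>+s. G (F (y, s)) \<partial>lborel \<partial>lborel)"
    by (rule lborel.nn_integral_fst[symmetric]) (simp add: lborel_prod)
  also have "\<dots> = (\<integral>\<^sup>+y. \<integral>\<^sup>+q. f (\<tau> q) * (ennreal (norm y) * indicator (cball 0 (c q)) (y::real^4)) \<partial>lborel \<partial>lborel)"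
  proof (rule nn_integral_cong_AE)
    show "AE y in lborel. (\<integral>\<^sup>+s. G (F (y, s)) \<partial>lborel) = (\<integral>\<^sup>+q. f (\<tau> q) * (ennreal (norm y) * indicator (cball 0 (c q)) y) \<partial>lborel)"
      using AE_lborel_singleton[of "0::real^4"] by eventually_elim (rule slice)
  qed
  \<comment> \<open>For fixed \<open>q\<close> the admissible \<open>y\<close> form a ball of radius
    \<open>c q\<close>, so integrating over \<open>y\<close> first is explicit.\<close>
  also have "\<dots> = (\<integral>\<^sup>+q. \<integral>\<^sup>+y. f (\<tau> q) * (ennreal (norm y) * indicator (cball 0 (c q)) (y::real^4)) \<partial>lborel \<partial>lborel)"
    by (rule lborel_pair.Fubini') (simp add: indicator_def)
  also have "\<dots> = (\<integral>\<^sup>+q. f (\<tau> q) * (ennreal (c q ^ 5) * ?\<kappa>) \<partial>lborel)"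
  proof (rule nn_integral_cong)
    fix q
    have "(\<integral>\<^sup>+y. f (\<tau> q) * (ennreal (norm y) * indicator (cball 0 (c q)) (y::real^4)) \<partial>lborel) =
        f (\<tau> q) * (\<integral>\<^sup>+y. ennreal (norm y) * indicator (cball 0 (c q)) (y::real^4) \<partial>lborel)"
      by (rule nn_integral_cmult) simp
    also have "\<dots> = f (\<tau> q) * (ennreal (c q ^ 5) * ?\<kappa>)"
      using nn_integral_norm_cball[OF c_nonneg, of q, where 'a = "real^4"] by (simp only: DIM_cart card_bit0 DIM_real mult_1_right) simp
    finally show "(\<integral>\<^sup>+y. f (\<tau> q) * (ennreal (norm y) * indicator (cball 0 (c q)) (y::real^4)) \<partial>lborel) =
        f (\<tau> q) * (ennreal (c q ^ 5) * ?\<kappa>)" .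
  qed
  also have "\<dots> = (\<integral>\<^sup>+q. ?\<kappa> * (f (\<tau> q) * ennreal ((1 - (\<tau> q)\<^sup>2) * \<rho> (\<tau> q) ^ 5) * ennreal (1 / sqrt (1 + q\<^sup>2) ^ 3)) \<partial>lborel)"
  proof (intro nn_integral_cong)
    fix q
    define w where "w = sqrt (1 + q\<^sup>2)"
    have w: "w > 0" "w\<^sup>2 = 1 + q\<^sup>2" using pos[of q] by (auto simp: w_def)
    have "1 - (\<tau> q)\<^sup>2 = 1 / w\<^sup>2"
    proof -
      have "(\<tau> q)\<^sup>2 = q\<^sup>2 / w\<^sup>2" by (simp add: \<tau>_def w_def power_divide)
      then show ?thesis using w pos[of q] by (simp add: field_simps)
    qed
    \<comment> \<open>Of the factor \<open>1 / w ^ 5\<close> in \<open>c q ^ 5\<close>, the part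
      \<open>1 / w\<^sup>2\<close> becomes the weight \<open>1 - (\<tau> q)\<^sup>2\<close>, and
      \<open>1 / w ^ 3\<close> is the derivative of \<tau> required by the substitution.\<close>
    then have "c q ^ 5 = (1 - (\<tau> q)\<^sup>2) * \<rho> (\<tau> q) ^ 5 * (1 / w ^ 3)"
      by (simp add: c_def w_def[symmetric] power_divide flip: power_add)
    moreover have "0 \<le> (1 - (\<tau> q)\<^sup>2) * \<rho> (\<tau> q) ^ 5"
      using \<open>1 - (\<tau> q)\<^sup>2 = 1 / w\<^sup>2\<close> \<rho>_nonneg by simp
    ultimately have "ennreal (c q ^ 5) = ennreal ((1 - (\<tau> q)\<^sup>2) * \<rho> (\<tau> q) ^ 5) * ennreal (1 / w ^ 3)"
      using w(1) by (metis ennreal_mult zero_le_divide_1_iff zero_le_power less_imp_le)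
    then show "f (\<tau> q) * (ennreal (c q ^ 5) * ?\<kappa>) = ?\<kappa> * (f (\<tau> q) * ennreal ((1 - (\<tau> q)\<^sup>2) * \<rho> (\<tau> q) ^ 5) * ennreal (1 / sqrt (1 + q\<^sup>2) ^ 3))"
      by (simp add: w_def mult_ac)
  qed
  also have "\<dots> = ?\<kappa> * (\<integral>\<^sup>+q. (f (\<tau> q) * ennreal ((1 - (\<tau> q)\<^sup>2) * \<rho> (\<tau> q) ^ 5)) * ennreal (1 / sqrt (1 + q\<^sup>2) ^ 3) \<partial>lborel)"
    by (rule nn_integral_cmult) measurable
  also have "\<dots> = ?\<kappa> * (\<integral>\<^sup>+t. f t * ennreal ((1 - t\<^sup>2) * \<rho> t ^ 5) * indicator {-1<..<1} t \<partial>lborel)"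
    unfolding \<tau>_def by (subst nn_integral_substitution_tangent) measurable
  finally show ?thesis by (simp add: G_def)
qed

section \<open>Central sections of bodies of revolution\<close>

text \<open>This is one fifth of the surface area of the unit sphere in \<open>real^4\<close>. As a
  finite positive constant it is absorbed into the factor \<open>C\<close> below.\<close>

definition norm_mass :: real where
  "norm_mass = enn2real (\<integral>\<^sup>+y. ennreal (norm y) * indicator (cball 0 1) (y::real^4) \<partial>lborel)"

lemma norm_mass:
  "(\<integral>\<^sup>+y. ennreal (norm y) * indicator (cball 0 1) (y::real^4) \<partial>lborel) = ennreal norm_mass"
  "0 < norm_mass"
proof -
  let ?I = "\<integral>\<^sup>+y. ennreal (norm y) * indicator (cball 0 1) (y::real^4) \<partial>lborel"
  have "?I \<le> (\<integral>\<^sup>+y. indicator (cball 0 1) (y::real^4) \<partial>lborel)"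
    by (intro nn_integral_mono) (auto simp: indicator_def)
  also have "\<dots> = emeasure lborel (cball 0 1 :: (real^4) set)" by simp
  also have "\<dots> < \<infinity>" by (rule emeasure_bounded_finite) simp
  finally have fin: "?I < \<infinity>" .
  have "?I \<noteq> 0"
  proof
    assume "?I = 0"
    then have "AE y in lborel. ennreal (norm y) * indicator (cball 0 1) (y::real^4) = 0"
      by (subst (asm) nn_integral_0_iff_AE) simp_all
    then have "AE y in lborel. (y::real^4) \<notin> ball 0 1"
      using AE_lborel_singleton[of "0::real^4"]
      by eventually_elim (auto simp: indicator_def split: if_splits)
    then have "emeasure lborel (ball 0 1 :: (real^4) set) = 0"
      by (subst (asm) AE_iff_measurable[of "ball 0 1"]) auto
    then have "measure lborel (ball 0 1 :: (real^4) set) = 0" by (simp add: measure_def)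
    then show False using content_ball_pos[of 1 "0::real^4"] by simp
  qed
  with fin show "?I = ennreal norm_mass" "0 < norm_mass"
    by (auto simp: norm_mass_def enn2real_positive_iff less_top zero_less_iff_neq_zero)
qed

text \<open>The vector \<open>u\<close> is the pullback of the orthogonal projection of
  \<open>w\<close> onto the hyperplane, and Pythagoras gives its norm. For section volumes
  \<open>w\<close> is the axis; for the average over the equator \<xi> is the axis.\<close>

lemma isometric_param_inner:
  assumes \<phi>: "isometric_param {x. \<xi> \<bullet> x = 0} \<phi>" and \<xi>: "norm \<xi> = 1"
  obtains u where "(norm u)\<^sup>2 = (norm w)\<^sup>2 - (w \<bullet> \<xi>)\<^sup>2" "\<And>Y. \<phi> Y \<bullet> w = Y \<bullet> u"
proof -
  have lin: "linear \<phi>" and n: "\<And>y. norm (\<phi> y) = norm y" and r: "range \<phi> = {x. \<xi> \<bullet> x = 0}"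
    using \<phi> by (auto simp: isometric_param_def)
  have \<xi>\<xi>: "\<xi> \<bullet> \<xi> = 1" using \<xi> by (simp add: norm_eq_1)
  define v where "v = w - (w \<bullet> \<xi>) *\<^sub>R \<xi>"
  have "\<xi> \<bullet> v = 0" by (simp add: v_def inner_diff_right \<xi>\<xi> inner_commute)
  then have "v \<in> range \<phi>" using r by blast
  then obtain u where u: "v = \<phi> u" by blast
  have "\<phi> Y \<bullet> w = Y \<bullet> u" for Y
  proof -
    have "\<phi> Y \<bullet> \<xi> = 0" using r by (auto simp: inner_commute)
    then have "\<phi> Y \<bullet> w = \<phi> Y \<bullet> \<phi> u" by (simp add: v_def inner_diff_right flip: u)
    \<comment> \<open>The parametrization is given as norm preserving; polarization makes it
      preserve inner products.\<close>
    also have "\<dots> = Y \<bullet> u" by (simp add: dot_norm n flip: linear_add[OF lin])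
    finally show ?thesis .
  qed
  moreover have "(norm u)\<^sup>2 = (norm w)\<^sup>2 - (w \<bullet> \<xi>)\<^sup>2"
  proof -
    have "(norm u)\<^sup>2 = v \<bullet> v" by (simp add: u n dot_square_norm)
    also have "\<dots> = (norm w)\<^sup>2 - (w \<bullet> \<xi>)\<^sup>2"
      using dot_square_norm[of w]
      by (simp add: v_def inner_diff_left inner_diff_right \<xi>\<xi> inner_commute[of \<xi> w] power2_eq_square)
    finally show ?thesis .
  qed
  ultimately show ?thesis using that by blast
qed

lemma unit_vector_axis_decomposition:
  fixes w :: "real^6"
  assumes "norm w = 1"
  obtains \<eta> where "norm \<eta> = 1" "\<eta> $ 6 = 0" "w = sqrt (1 - (w $ 6)\<^sup>2) *\<^sub>R \<eta> + (w $ 6) *\<^sub>R axis 6 1"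
proof -
  define v where "v = w - (w $ 6) *\<^sub>R axis 6 1"
  have ww: "w \<bullet> w = 1" using assms by (simp add: norm_eq_1)
  have v6: "v $ 6 = 0" by (simp add: v_def)
  have vv: "v \<bullet> v = 1 - (w $ 6)\<^sup>2"
    by (simp add: v_def inner_diff_left inner_diff_right ww inner_axis inner_axis' power2_eq_square inner_commute[of "axis 6 1" w])
  then have nv: "norm v = sqrt (1 - (w $ 6)\<^sup>2)" by (simp add: norm_eq_sqrt_inner)
  show ?thesis
  proof (cases "v = 0")
    \<comment> \<open>At a pole the coefficient of \<eta> vanishes, so any equatorial unit vector
      serves.\<close>
    case True
    have "norm (axis 1 1 :: real^6) = 1" "(axis 1 1 :: real^6) $ 6 = 0" by (rule norm_axis_1) (simp add: axis_def)
    moreover have "w = sqrt (1 - (w $ 6)\<^sup>2) *\<^sub>R axis 1 1 + (w $ 6) *\<^sub>R axis 6 1"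
      using True nv by (simp add: v_def)
    ultimately show ?thesis by (rule that)
  next
    case False
    then have "norm (v /\<^sub>R norm v) = 1" "(v /\<^sub>R norm v) $ 6 = 0"
      "w = sqrt (1 - (w $ 6)\<^sup>2) *\<^sub>R (v /\<^sub>R norm v) + (w $ 6) *\<^sub>R axis 6 1"
      using v6 by (simp_all add: nv[symmetric]) (simp add: v_def)
    then show ?thesis by (rule that)
  qed
qed

text \<open>Compactness makes the supremum in \<open>radial_fun\<close> a maximum, and convexity
  together with \<open>0 \<in> K\<close> puts the whole segment below it into
  \<open>K\<close>.\<close>

lemma mem_iff_radial_fun:
  assumes K: "compact K" "convex K" "0 \<in> K" and w: "norm w = 1" and l: "0 \<le> l"
  shows "l *\<^sub>R w \<in> K \<longleftrightarrow> l \<le> radial_fun K w"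
proof -
  let ?S = "{l. 0 \<le> l \<and> l *\<^sub>R w \<in> K}"
  obtain B where B: "\<forall>x\<in>K. norm x \<le> B"
    using compact_imp_bounded[OF K(1)] unfolding bounded_iff by blast
  have ne: "0 \<in> ?S" using K by simp
  have bdd: "bdd_above ?S"
  proof (rule bdd_aboveI[of _ B])
    fix l assume "l \<in> ?S"
    then have "0 \<le> l" "norm (l *\<^sub>R w) \<le> B" using B by blast+
    then show "l \<le> B" using w by simp
  qed
  have "closed ?S"
  proof -
    have "?S = {0..} \<inter> (\<lambda>l. l *\<^sub>R w) -` K" by auto
    moreover have "closed ((\<lambda>l. l *\<^sub>R w) -` K)"
      by (intro closed_vimage compact_imp_closed K continuous_intros)
    ultimately show ?thesis by (simp add: closed_Int)
  qed
  moreover have "?S \<noteq> {}" using ne by (metis empty_iff)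
  ultimately have "Sup ?S \<in> ?S" using bdd by (intro closed_contains_Sup)
  then have "radial_fun K w \<in> ?S" by (simp only: radial_fun_def)
  then have sup: "0 \<le> radial_fun K w" "radial_fun K w *\<^sub>R w \<in> K" by blast+
  show ?thesis
  proof
    assume "l *\<^sub>R w \<in> K"
    then show "l \<le> radial_fun K w" unfolding radial_fun_def using l bdd by (intro cSup_upper) auto
  next
    assume le: "l \<le> radial_fun K w"
    show "l *\<^sub>R w \<in> K"
    proof (cases "radial_fun K w = 0")
      case True
      then show ?thesis using le l K by simp
    next
      case False
      have "(l / radial_fun K w) *\<^sub>R (radial_fun K w *\<^sub>R w) + (1 - l / radial_fun K w) *\<^sub>R 0 \<in> K"
        using sup le l K False by (intro convexD) (auto simp: divide_simps)
      then show ?thesis using False by simp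
    qed
  qed
qed

text \<open>The interior is convex and invariant under negation, so it contains the midpoint of
  \<open>x\<close> and \<open>- x\<close>.\<close>

lemma origin_symmetric_zero_interior:
  fixes K :: "'a::euclidean_space set"
  assumes "convex_body K" "origin_symmetric K"
  shows "0 \<in> interior K"
proof -
  obtain x where x: "x \<in> interior K" using assms by (auto simp: convex_body_def)
  have "uminus ` interior K \<subseteq> interior K"
  proof (rule interior_maximal)
    show "uminus ` interior K \<subseteq> K"
      using assms(2) interior_subset by (force simp: origin_symmetric_def)
    show "open (uminus ` interior K)" by (rule open_negations) simp
  qed
  then have "- x \<in> interior K" using x by blast
  moreover have "convex (interior K)" using assms by (simp add: convex_body_def convex_interior)
  ultimately have "(1/2) *\<^sub>R x + (1/2) *\<^sub>R (- x) \<in> interior K" using x by (intro convexD) auto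
  then show ?thesis by simp
qed

section \<open>The profile of a fixed body of revolution and its central sections\<close>

locale revolution_body =
  fixes K :: "(real^6) set"
  assumes K: "convex_body K" "origin_symmetric K" "body_of_revolution K"
begin

abbreviation "\<rho> \<equiv> radial_profile K"

lemma compact_K: "compact K" and convex_K: "convex K" and zero_K: "0 \<in> K"
  using K origin_symmetric_zero_interior[OF K(1,2)] interior_subset by (auto simp: convex_body_def)

lemma radial_fun_uminus: "radial_fun K (- w) = radial_fun K w"
proof -
  have "x \<in> K" if "- x \<in> K" for x using K(2) that unfolding origin_symmetric_def by (metis minus_minus)
  then have "- x \<in> K \<longleftrightarrow> x \<in> K" for x using K(2) unfolding origin_symmetric_def by blast
  then show ?thesis by (simp add: radial_fun_def)
qed

text \<open>Rotations about the axis remove the dependence on the equatorial component; central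
  symmetry then allows the absolute value, which brings the argument into
  \<open>{0..1}\<close>.\<close>

lemma radial_fun_eq_profile:
  assumes w: "norm w = 1"
  shows "radial_fun K w = \<rho> \<bar>w $ 6\<bar>"
proof -
  have *: "radial_fun K w = \<rho> (w $ 6)" if w: "norm w = 1" for w
  proof -
    obtain \<eta> where \<eta>: "norm \<eta> = 1" "\<eta> $ 6 = 0" "w = sqrt (1 - (w $ 6)\<^sup>2) *\<^sub>R \<eta> + (w $ 6) *\<^sub>R axis 6 1"
      using unit_vector_axis_decomposition[OF w] .
    show ?thesis using radial_profile_eq[OF K(3) \<eta>(1,2), of "w $ 6"] \<eta>(3) by simp
  qed
  show ?thesis
  proof (cases "0 \<le> w $ 6")
    case True
    then show ?thesis by (simp add: *[OF w])
  next
    case False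
    then show ?thesis using *[of "- w"] w by (simp add: radial_fun_uminus)
  qed
qed

lemma direction:
  assumes "\<bar>t\<bar> \<le> 1"
  shows "norm (sqrt (1 - t\<^sup>2) *\<^sub>R axis 1 1 + t *\<^sub>R axis 6 1 :: real^6) = 1" (is "norm ?w = 1")
    and "(sqrt (1 - t\<^sup>2) *\<^sub>R axis 1 1 + t *\<^sub>R axis 6 1 :: real^6) $ 6 = t"
proof -
  have "t\<^sup>2 \<le> 1" using assms by (simp add: abs_square_le_1)
  then have "?w \<bullet> ?w = 1"
    by (simp add: inner_add_left inner_add_right inner_axis_axis power2_eq_square flip: real_sqrt_mult)
  then show "norm ?w = 1" by (simp add: norm_eq_1)
  show "?w $ 6 = t" by (simp add: axis_def)
qed

lemma profile_bounds:
  obtains e B where "0 < e" "\<And>t. 0 \<le> t \<Longrightarrow> t \<le> 1 \<Longrightarrow> e \<le> \<rho> t \<and> \<rho> t \<le> B"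
proof -
  obtain e where e: "0 < e" "cball 0 e \<subseteq> K"
    using origin_symmetric_zero_interior[OF K(1,2)] by (auto simp: mem_interior_cball)
  obtain B where B: "\<And>x. x \<in> K \<Longrightarrow> norm x \<le> B"
    using compact_K compact_imp_bounded bounded_iff by metis
  have "e \<le> \<rho> t \<and> \<rho> t \<le> B" if t: "0 \<le> t" "t \<le> 1" for t
  proof -
    define w :: "real^6" where "w = sqrt (1 - t\<^sup>2) *\<^sub>R axis 1 1 + t *\<^sub>R axis 6 1"
    have w: "norm w = 1" "w $ 6 = t" using direction[of t] t by (auto simp: w_def)
    have r: "radial_fun K w = \<rho> t" using radial_fun_eq_profile[OF w(1)] t w(2) by simp
    note mem = mem_iff_radial_fun[OF compact_K convex_K zero_K w(1), unfolded r]
    have "e *\<^sub>R w \<in> K" using e w by auto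
    then have "e \<le> \<rho> t" using mem e(1) by simp
    then have "\<rho> t *\<^sub>R w \<in> K" using mem[of "\<rho> t"] e(1) by simp
    with \<open>e \<le> \<rho> t\<close> e(1) B[of "\<rho> t *\<^sub>R w"] w show ?thesis by simp
  qed
  then show ?thesis using e(1) that by blast
qed

lemma mem_iff_profile: "v \<in> K \<longleftrightarrow> norm v \<le> \<rho> \<bar>v $ 6 / norm v\<bar>"
proof (cases "v = 0")
  case True
  \<comment> \<open>For \<open>v = 0\<close> the quotient 0 / 0 is 0, so the right-hand side reads
    \<open>0 \<le> \<rho> 0\<close> and follows from positivity of the profile.\<close>
  obtain e where "0 < e" "e \<le> \<rho> 0" using profile_bounds[of thesis] by force
  then show ?thesis using True zero_K by simp
next
  case False
  then have w: "norm (v /\<^sub>R norm v) = 1" by simp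
  have "v \<in> K \<longleftrightarrow> norm v *\<^sub>R (v /\<^sub>R norm v) \<in> K" using False by simp
  also have "\<dots> \<longleftrightarrow> norm v \<le> \<rho> \<bar>(v /\<^sub>R norm v) $ 6\<bar>"
    using mem_iff_radial_fun[OF compact_K convex_K zero_K w] radial_fun_eq_profile[OF w] by simp
  finally show ?thesis by (simp add: divide_inverse_commute)
qed

text \<open>The argument is clamped because the profile is meaningful only on \<open>[0,1]\<close>.\<close>

definition profile_ext :: "real \<Rightarrow> real" where
  "profile_ext t = \<rho> (min 1 \<bar>t\<bar>)"

lemma profile_ext_pos: "0 < profile_ext t"
  using profile_bounds[of thesis] unfolding profile_ext_def
  by (metis abs_ge_zero less_le_trans min.cobounded1 min_def zero_le_one profile_bounds)

lemma profile_ext_eq: "\<bar>t\<bar> \<le> 1 \<Longrightarrow> profile_ext t = \<rho> \<bar>t\<bar>"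
  by (simp add: profile_ext_def min_def)

text \<open>For positive \<open>a\<close> the superlevel set is the preimage of the closed set
  \<open>K\<close> under the continuous curve \<open>d\<close> at distance \<open>a\<close> from the
  origin. Measurability thus comes from upper semicontinuity.\<close>

lemma profile_ext_measurable [measurable]: "profile_ext \<in> borel_measurable borel"
proof (rule borel_measurableI_ge)
  fix a
  show "{t \<in> space borel. a \<le> profile_ext t} \<in> sets borel"
  proof (cases "0 < a")
    case False
    then have "{t \<in> space borel. a \<le> profile_ext t} = UNIV"
      using profile_ext_pos by (auto simp: not_less intro: less_imp_le order_trans)
    then show ?thesis by simp
  next
    case True
    define d where "d t = a *\<^sub>R (sqrt (1 - (min 1 \<bar>t\<bar>)\<^sup>2) *\<^sub>R axis 1 1 + min 1 \<bar>t\<bar> *\<^sub>R axis 6 1 :: real^6)" for t :: real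
    have "a \<le> profile_ext t \<longleftrightarrow> d t \<in> K" for t
    proof -
      have n: "norm (d t) = a" "d t $ 6 = a * min 1 \<bar>t\<bar>"
        using direction[of "min 1 \<bar>t\<bar>"] True by (auto simp: d_def simp del: vector_add_component)
      show ?thesis using True by (simp add: mem_iff_profile n profile_ext_def)
    qed
    then have "{t \<in> space borel. a \<le> profile_ext t} = d -` K" by auto
    moreover have "closed (d -` K)"
      unfolding d_def by (intro closed_vimage compact_imp_closed compact_K continuous_intros)
    ultimately show ?thesis by (simp add: borel_closed)
  qed
qed

text \<open>The number \<open>x\<close> is the length of the projection of the axis onto the
  hyperplane, so a direction in the hyperplane with cosine \<open>t\<close> to that projection has
  cosine \<open>x * t\<close> to the axis. In isometric coordinates the section is therefore a
  region as in \<open>nn_integral_zonal\<close>.\<close>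

lemma emeasure_section:
  assumes \<xi>: "norm \<xi> = 1" and x: "0 < x" "x\<^sup>2 = 1 - (\<xi> $ 6)\<^sup>2"
  shows "ennreal (section_volume K {y. \<xi> \<bullet> y = 0}) =
    ennreal norm_mass * (\<integral>\<^sup>+t. ennreal ((1 - t\<^sup>2) * profile_ext (x * t) ^ 5) * indicator {-1<..<1} t \<partial>lborel)"
proof -
  have "\<xi> \<noteq> 0" using \<xi> by auto
  then obtain \<phi> where \<phi>: "isometric_param {y. \<xi> \<bullet> y = 0} \<phi>" using isometric_param_exists by blast
  obtain u where u: "(norm u)\<^sup>2 = (norm (axis 6 1 :: real^6))\<^sup>2 - (axis 6 1 \<bullet> \<xi>)\<^sup>2" "\<And>Y. \<phi> Y \<bullet> axis 6 1 = Y \<bullet> u"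
    using isometric_param_inner[OF \<phi> \<xi>] by blast
  have "(norm u)\<^sup>2 = x\<^sup>2" using u(1) x by (simp add: inner_axis' norm_axis_1)
  then have nu: "norm u = x" using x(1) by simp
  define p where "p = u /\<^sub>R x"
  have p: "norm p = 1" using nu x(1) by (simp add: p_def)
  have \<phi>6: "\<phi> Y $ 6 = x * (Y \<bullet> p)" for Y
    using u(2)[of Y] x(1) by (simp add: inner_axis p_def)
  have n: "norm (\<phi> Y) = norm Y" and lin: "linear \<phi>" for Y using \<phi> by (auto simp: isometric_param_def)
  have mem: "\<phi> Y \<in> K \<longleftrightarrow> norm Y \<le> profile_ext (x * (Y \<bullet> p / norm Y))" for Y
  proof -
    have "\<bar>x * (Y \<bullet> p / norm Y)\<bar> \<le> 1"
    proof -
      have "x \<le> 1" using x by (metis abs_square_le_1 diff_ge_0_iff_ge le_add_same_cancel1 abs_le_iff diff_add_cancel zero_le_power2)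
      moreover have "\<bar>Y \<bullet> p / norm Y\<bar> \<le> 1"
        using Cauchy_Schwarz_ineq2[of Y p] p by (cases "Y = 0") (simp_all add: divide_simps)
      ultimately have "\<bar>x\<bar> * \<bar>Y \<bullet> p / norm Y\<bar> \<le> 1 * 1" using x(1) by (intro mult_mono) auto
      then show ?thesis by (simp only: abs_mult mult_1)
    qed
    then show ?thesis by (simp add: mem_iff_profile n \<phi>6 profile_ext_eq)
  qed
  have cont: "continuous_on UNIV \<phi>" using lin by (simp add: linear_continuous_on linear_linear)
  have cl: "closed (\<phi> -` K)" by (intro closed_vimage compact_imp_closed compact_K cont)
  have "bounded (\<phi> -` K)" using compact_imp_bounded[OF compact_K] unfolding bounded_iff by (metis n vimage_eq)
  with cl have comp: "compact (\<phi> -` K)" by (simp add: compact_eq_bounded_closed)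
  have "ennreal (section_volume K {y. \<xi> \<bullet> y = 0}) = emeasure lebesgue (\<phi> -` K)"
    using section_volume_eq[OF \<phi> compact_K] lmeasurable_compact[OF comp] by (simp add: emeasure_eq_measure2)
  also have "\<dots> = emeasure lborel (\<phi> -` K)" using cl by (simp add: borel_closed)
  also have "\<dots> = (\<integral>\<^sup>+Y. indicator (\<phi> -` K) Y \<partial>lborel)" using cl by (simp add: borel_closed)
  also have "\<dots> = (\<integral>\<^sup>+Y. (\<lambda>_. 1) (Y \<bullet> p / norm Y) *
       indicator {Y. norm Y \<le> (\<lambda>t. profile_ext (x * t)) (Y \<bullet> p / norm Y)} Y \<partial>lborel)"
    by (intro nn_integral_cong) (auto simp: indicator_def mem)
  also have "\<dots> = ennreal norm_mass * (\<integral>\<^sup>+t. 1 * ennreal ((1 - t\<^sup>2) * profile_ext (x * t) ^ 5) * indicator {-1<..<1} t \<partial>lborel)"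
    using profile_ext_pos by (subst nn_integral_zonal[OF p]) (auto simp: norm_mass less_imp_le)
  finally show ?thesis by simp
qed

text \<open>A bounded measurable function on a bounded interval is integrable; measurability is
  taken from \<open>profile_ext\<close>, which agrees with the profile on
  \<open>{0..1}\<close>.\<close>

lemma integrable_profile:
  assumes "continuous_on {0..1} q" "x \<le> 1"
  shows "(\<lambda>t. q t * \<rho> t ^ 5) integrable_on {0..x}"
proof -
  have "(\<lambda>t. q t * profile_ext t ^ 5) integrable_on {0..1}"
  proof -
    obtain e B where B: "0 < e" "\<And>t. 0 \<le> t \<Longrightarrow> t \<le> 1 \<Longrightarrow> e \<le> \<rho> t \<and> \<rho> t \<le> B"
      using profile_bounds by blast
    have "bounded (q ` {0..1})" using assms by (intro compact_imp_bounded compact_continuous_image) auto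
    then obtain C where C: "\<And>t. t \<in> {0..1} \<Longrightarrow> \<bar>q t\<bar> \<le> C"
      unfolding bounded_iff by (metis imageI real_norm_def)
    show ?thesis
    proof (rule measurable_bounded_by_integrable_imp_integrable)
      have "q \<in> borel_measurable (lebesgue_on {0..1})"
        using assms(1) by (rule continuous_imp_measurable_on_sets_lebesgue) simp
      moreover have "(\<lambda>t. profile_ext t ^ 5) \<in> borel_measurable (lebesgue_on {0..1})"
        by (intro measurable_restrict_space1 measurable_completion) simp
      ultimately show "(\<lambda>t. q t * profile_ext t ^ 5) \<in> borel_measurable (lebesgue_on {0..1})" by simp
      show "norm (q t * profile_ext t ^ 5) \<le> C * B ^ 5" if "t \<in> {0..1}" for t
        using that B(1) B(2)[of t] C[of t] profile_ext_pos[of t]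
        by (auto simp: abs_mult profile_ext_eq intro!: mult_mono power_mono)
    qed auto
  qed
  then have "(\<lambda>t. q t * \<rho> t ^ 5) integrable_on {0..1}"
    by (rule integrable_eq) (simp add: profile_ext_eq)
  then show ?thesis by (rule integrable_on_subinterval) (use assms(2) in auto)
qed

text \<open>In the notation of the theorem, \<open>P x = h x / x\<^sup>2\<close>.\<close>

definition P :: "real \<Rightarrow> real" where
  "P x = integral {0..x} (\<lambda>t. (1 - t\<^sup>2 / x\<^sup>2) * \<rho> t ^ 5)"

lemma section_volume_eq_P:
  assumes \<xi>: "norm \<xi> = 1" and x: "0 < x" "x\<^sup>2 = 1 - (\<xi> $ 6)\<^sup>2"
  shows "section_volume K {y. \<xi> \<bullet> y = 0} = 2 * norm_mass * P x / x"
proof -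
  have x1: "x \<le> 1" using x by (metis abs_square_le_1 diff_ge_0_iff_ge le_add_same_cancel1 abs_le_iff diff_add_cancel zero_le_power2)
  let ?g = "\<lambda>t. (1 - t\<^sup>2) * profile_ext (x * t) ^ 5"
  have "(\<lambda>t. (1 - t\<^sup>2 / x\<^sup>2) * \<rho> t ^ 5) integrable_on {0..x}"
    using x1 x(1) by (intro integrable_profile continuous_intros) auto
  then have "((\<lambda>t. (1 - t\<^sup>2 / x\<^sup>2) * \<rho> t ^ 5) has_integral P x) {0..x}"
    by (simp add: P_def integrable_integral)
  \<comment> \<open>The substitution t = x s turns the weight into \<open>1 - s\<^sup>2\<close> and
    produces the factor \<open>1 / x\<close>; the reflected half later doubles the value.\<close>
  then have "((\<lambda>s. (1 - (x * s)\<^sup>2 / x\<^sup>2) * \<rho> (x * s) ^ 5) has_integral P x / x) ((\<lambda>t. t / x) ` {0..x})"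
    using x(1) has_integral_stretch_real[of _ "P x" 0 x x] by fastforce
  moreover have "(\<lambda>t. t / x) ` {0..x} = {0..1}"
    using x(1) by (simp add: image_divide_atLeastAtMost)
  ultimately have "((\<lambda>s. (1 - (x * s)\<^sup>2 / x\<^sup>2) * \<rho> (x * s) ^ 5) has_integral P x / x) {0..1}" by simp
  then have 1: "(?g has_integral P x / x) {0..1}"
    by (rule has_integral_eq[rotated]) (use x(1) x1 in \<open>simp add: profile_ext_eq power_mult_distrib abs_mult mult_le_one\<close>)
  have "((\<lambda>t. ?g (- t)) has_integral P x / x) {-1..0}"
    using 1 by (subst has_integral_reflect_real[symmetric]) simp
  moreover have "profile_ext (- t) = profile_ext t" for t by (simp add: profile_ext_def)
  ultimately have 2: "(?g has_integral P x / x) {-1..0}" by simp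
  have "(?g has_integral P x / x + P x / x) {-1..1}"
    by (rule has_integral_combine[OF _ _ 2 1]) auto
  then have "(?g has_integral 2 * P x / x) {-1<..<1}"
    by (simp add: has_integral_Icc_iff_Ioo)
  moreover have nonneg: "0 \<le> ?g t" if "t \<in> {-1<..<1}" for t
    using that profile_ext_pos[of "x * t"] by (auto simp: abs_square_le_1 intro!: mult_nonneg_nonneg)
  ultimately have I: "(\<integral>\<^sup>+t. ennreal (indicator {-1<..<1} t * ?g t) \<partial>lborel) = ennreal (2 * P x / x)"
    by (intro nn_integral_has_integral_lebesgue)
  have "0 \<le> 2 * P x / x"
    using \<open>(?g has_integral 2 * P x / x) {-1<..<1}\<close> nonneg by (rule has_integral_nonneg)
  have "ennreal (section_volume K {y. \<xi> \<bullet> y = 0}) = ennreal norm_mass * (\<integral>\<^sup>+t. ennreal (indicator {-1<..<1} t * ?g t) \<partial>lborel)"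
    unfolding emeasure_section[OF assms] by (intro arg_cong2[where f="(*)"] refl nn_integral_cong) (simp add: indicator_def)
  also have "\<dots> = ennreal (norm_mass * (2 * P x / x))"
    unfolding I using norm_mass(2) by (subst ennreal_mult') simp_all
  finally have eq: "ennreal (section_volume K {y. \<xi> \<bullet> y = 0}) = ennreal (norm_mass * (2 * P x / x))" .
  \<comment> \<open>Both sides must be known to be nonnegative, because \<open>ennreal\<close> sends
    all negative numbers to 0.\<close>
  have "0 \<le> section_volume K {y. \<xi> \<bullet> y = 0}" by (simp add: section_volume_def)
  moreover have "0 \<le> norm_mass * (2 * P x / x)"
    using norm_mass(2) \<open>0 \<le> 2 * P x / x\<close> by (intro mult_nonneg_nonneg) auto
  ultimately have "section_volume K {y. \<xi> \<bullet> y = 0} = norm_mass * (2 * P x / x)"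
    using eq by (subst (asm) ennreal_inj)
  then show ?thesis by simp
qed

end

section \<open>Averaged representation of zonoids\<close>

text \<open>Closed form of \<open>\<integral> (1 - t\<^sup>2) \<bar>\<alpha> t + c\<bar> dt\<close> over \<open>[-1,1]\<close> for \<open>\<alpha>, c \<ge> 0\<close>. For \<open>\<alpha> = 0\<close> the junk value
  \<open>c / 0\<close> is harmless, and the same holds in the derivatives of the kernel.\<close>

definition zonal_kernel :: "real \<Rightarrow> real \<Rightarrow> real" where
  "zonal_kernel \<alpha> c = 4/3 * c + \<alpha> * (2/3 * max 0 (1 - c / \<alpha>) ^ 3 - max 0 (1 - c / \<alpha>) ^ 4 / 6)"

text \<open>For nonnegative \<open>c\<close>, either \<open>\<alpha> \<le> c\<close> and
  \<open>\<alpha> * t + c\<close> keeps its sign on the interval, or the integral is split at the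
  zero \<open>- c / \<alpha>\<close>. \<open>F\<close> is an antiderivative of the integrand without
  the absolute value.\<close>

lemma has_integral_zonal_kernel:
  assumes \<alpha>: "0 \<le> \<alpha>"
  shows "((\<lambda>t. (1 - t\<^sup>2) * \<bar>\<alpha> * t + c\<bar>) has_integral zonal_kernel \<alpha> \<bar>c\<bar>) {-1..1}"
proof -
  have main: "((\<lambda>t. (1 - t\<^sup>2) * \<bar>\<alpha> * t + c\<bar>) has_integral zonal_kernel \<alpha> c) {-1..1}" if c: "0 \<le> c" for c
  proof -
    define F where "F t = \<alpha> * t\<^sup>2 / 2 + c * t - \<alpha> * t ^ 4 / 4 - c * t ^ 3 / 3" for t :: real
    have F: "((\<lambda>t. (1 - t\<^sup>2) * (\<alpha> * t + c)) has_integral F b - F a) {a..b}" if "a \<le> b" for a b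
      using that
      by (intro fundamental_theorem_of_calculus)
         (auto simp: F_def has_real_derivative_iff_has_vector_derivative[symmetric] algebra_simps power2_eq_square power3_eq_cube
           intro!: derivative_eq_intros)
    show ?thesis
    proof (cases "\<alpha> \<le> c")
      case True
      have kernel: "zonal_kernel \<alpha> c = F 1 - F (-1)"
      proof (cases "\<alpha> = 0")
        case False
        \<comment> \<open>The positive parts vanish in this range, which leaves only the term
          \<open>4/3 * c\<close>.\<close>
        then have "max 0 (1 - c / \<alpha>) = 0" using True \<alpha> by (simp add: max_def divide_simps)
        then show ?thesis by (simp add: zonal_kernel_def F_def)
      qed (simp add: zonal_kernel_def F_def)
      have "((\<lambda>t. (1 - t\<^sup>2) * \<bar>\<alpha> * t + c\<bar>) has_integral F 1 - F (-1)) {-1..1}"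
      proof (rule has_integral_eq)
        show "((\<lambda>t. (1 - t\<^sup>2) * (\<alpha> * t + c)) has_integral F 1 - F (-1)) {-1..1}" by (intro F) simp
        fix t :: real assume "t \<in> {-1..1}"
        then have "\<alpha> * (- t) \<le> \<alpha> * 1" using \<alpha> by (intro mult_left_mono) auto
        then show "(1 - t\<^sup>2) * (\<alpha> * t + c) = (1 - t\<^sup>2) * \<bar>\<alpha> * t + c\<bar>" using True by simp
      qed
      then show ?thesis by (simp only: kernel)
    next
      case False
      define b where "b = c / \<alpha>"
      have b: "0 \<le> b" "b < 1" "c = \<alpha> * b" using False c by (auto simp: b_def)
      have "((\<lambda>t. (1 - t\<^sup>2) * \<bar>\<alpha> * t + c\<bar>) has_integral - (F (- b) - F (-1))) {-1..- b}"
      proof (rule has_integral_eq)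
        show "((\<lambda>t. - ((1 - t\<^sup>2) * (\<alpha> * t + c))) has_integral - (F (- b) - F (-1))) {-1..- b}"
          using b by (intro has_integral_neg F) auto
        fix t assume "t \<in> {-1..- b}"
        then have "\<alpha> * (t + b) \<le> 0" using \<alpha> by (intro mult_nonneg_nonpos) auto
        then have "\<bar>\<alpha> * t + c\<bar> = - (\<alpha> * t + c)"
          by (simp add: b(3) distrib_left)
        then show "- ((1 - t\<^sup>2) * (\<alpha> * t + c)) = (1 - t\<^sup>2) * \<bar>\<alpha> * t + c\<bar>"
          by (simp only: mult_minus_right)
      qed
      moreover have "((\<lambda>t. (1 - t\<^sup>2) * \<bar>\<alpha> * t + c\<bar>) has_integral F 1 - F (- b)) {- b..1}"
      proof (rule has_integral_eq)
        show "((\<lambda>t. (1 - t\<^sup>2) * (\<alpha> * t + c)) has_integral F 1 - F (- b)) {- b..1}"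
          using b by (intro F) auto
        fix t assume "t \<in> {- b..1}"
        then have "0 \<le> \<alpha> * (t + b)" using \<alpha> by (intro mult_nonneg_nonneg) auto
        then show "(1 - t\<^sup>2) * (\<alpha> * t + c) = (1 - t\<^sup>2) * \<bar>\<alpha> * t + c\<bar>"
          by (simp add: b(3) distrib_left)
      qed
      ultimately have "((\<lambda>t. (1 - t\<^sup>2) * \<bar>\<alpha> * t + c\<bar>) has_integral - (F (- b) - F (-1)) + (F 1 - F (- b))) {-1..1}"
        using b by (intro has_integral_combine) auto
      moreover have u: "max 0 (1 - c / \<alpha>) = 1 - b" using b(2) unfolding b_def by simp
      have "zonal_kernel \<alpha> c = - (F (- b) - F (-1)) + (F 1 - F (- b))"
      proof -
        have "4/3 * b + (2/3 * (1 - b) ^ 3 - (1 - b) ^ 4 / 6) = 1/2 + b\<^sup>2 - b ^ 4 / 6"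
          by (simp add: power2_eq_square power3_eq_cube power4_eq_xxxx field_simps)
        then have "\<alpha> * (4/3 * b + (2/3 * (1 - b) ^ 3 - (1 - b) ^ 4 / 6)) = \<alpha> * (1/2 + b\<^sup>2 - b ^ 4 / 6)"
          by (rule arg_cong)
        moreover have "zonal_kernel \<alpha> c = \<alpha> * (4/3 * b + (2/3 * (1 - b) ^ 3 - (1 - b) ^ 4 / 6))"
          unfolding zonal_kernel_def u by (simp add: b(3) algebra_simps)
        moreover have "- (F (- b) - F (-1)) + (F 1 - F (- b)) = \<alpha> * (1/2 + b\<^sup>2 - b ^ 4 / 6)"
          unfolding F_def b(3) by (simp add: power4_eq_xxxx) (simp add: power2_eq_square power3_eq_cube algebra_simps)
        ultimately show ?thesis by simp
      qed
      ultimately show ?thesis by simp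
    qed
  qed
  show ?thesis
  proof (cases "0 \<le> c")
    case False
    \<comment> \<open>The weight is even, so reflecting \<open>t\<close> exchanges \<open>c\<close>
      and \<open>- c\<close>.\<close>
    then have "((\<lambda>t. (1 - (- t)\<^sup>2) * \<bar>\<alpha> * (- t) + (- c)\<bar>) has_integral zonal_kernel \<alpha> (- c)) {-1..1}"
      using main[of "- c"] by (subst has_integral_reflect_real[of _ _ _ "-1", simplified]) simp
    moreover have "\<bar>\<alpha> * (- t) + (- c)\<bar> = \<bar>\<alpha> * t + c\<bar>" for t by simp
    ultimately show ?thesis using False by simp
  qed (simp add: main)
qed

lemma zonal_kernel_nonneg: "0 \<le> \<alpha> \<Longrightarrow> 0 \<le> zonal_kernel \<alpha> \<bar>c\<bar>"
  by (rule has_integral_nonneg[OF has_integral_zonal_kernel]) (auto simp: abs_square_le_1 intro!: mult_nonneg_nonneg)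

lemma nn_integral_zonal_kernel:
  assumes "0 \<le> \<alpha>"
  shows "(\<integral>\<^sup>+t. ennreal \<bar>\<alpha> * t + c\<bar> * ennreal (1 - t\<^sup>2) * indicator {-1<..<1} t \<partial>lborel) = ennreal (zonal_kernel \<alpha> \<bar>c\<bar>)"
proof -
  have "((\<lambda>t. (1 - t\<^sup>2) * \<bar>\<alpha> * t + c\<bar>) has_integral zonal_kernel \<alpha> \<bar>c\<bar>) {-1<..<1}"
    using has_integral_zonal_kernel[OF assms] by (simp add: has_integral_Icc_iff_Ioo)
  moreover have "0 \<le> (1 - t\<^sup>2) * \<bar>\<alpha> * t + c\<bar>" if "t \<in> {-1<..<1}" for t
    using that by (auto simp: abs_square_le_1 intro!: mult_nonneg_nonneg)
  ultimately have "(\<integral>\<^sup>+t. ennreal (indicator {-1<..<1} t * ((1 - t\<^sup>2) * \<bar>\<alpha> * t + c\<bar>)) \<partial>lborel) = ennreal (zonal_kernel \<alpha> \<bar>c\<bar>)"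
    by (intro nn_integral_has_integral_lebesgue)
  moreover have "ennreal (indicator {-1<..<1} t * ((1 - t\<^sup>2) * \<bar>\<alpha> * t + c\<bar>)) = ennreal \<bar>\<alpha> * t + c\<bar> * ennreal (1 - t\<^sup>2) * indicator {-1<..<1} t" for t
    by (auto simp: indicator_def ennreal_mult'' mult.commute abs_square_le_1)
  ultimately show ?thesis by simp
qed

text \<open>Comparing the membership of \<open>l *\<^sub>R \<xi>\<close> in the two sets gives
  \<open>l * h \<le> 1 \<longleftrightarrow> l \<le> V\<close> for all nonnegative \<open>l\<close>.
  Taking \<open>l = V + 1\<close> forces \<open>0 < h\<close>; taking \<open>l = 1 / h\<close> and
  \<open>l = V\<close> gives the two inequalities.\<close>

lemma support_fun_mult_section_volume:
  assumes Z: "compact Z" "Z \<noteq> {}" and polar: "intersection_body K = polar_body Z" and \<xi>: "norm \<xi> = 1"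
  shows "support_fun Z \<xi> * section_volume K {y. \<xi> \<bullet> y = 0} = 1"
proof -
  define V where "V = section_volume K {y. \<xi> \<bullet> y = 0}"
  define h where "h = support_fun Z \<xi>"
  have V: "0 \<le> V" by (simp add: V_def section_volume_def)
  have "bounded ((\<bullet>) \<xi> ` Z)"
    using Z by (intro compact_imp_bounded compact_continuous_image continuous_intros)
  then have bdd: "bdd_above ((\<bullet>) \<xi> ` Z)" by (rule bounded_imp_bdd_above)
  have in_polar: "l *\<^sub>R \<xi> \<in> polar_body Z \<longleftrightarrow> l * h \<le> 1" if "0 \<le> l" for l
  proof (cases "l = 0")
    case False
    then have l: "0 < l" using that by simp
    have "l *\<^sub>R \<xi> \<in> polar_body Z \<longleftrightarrow> (\<forall>y\<in>Z. \<xi> \<bullet> y \<le> 1 / l)"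
      using l by (simp add: polar_body_def pos_le_divide_eq mult.commute)
    also have "\<dots> \<longleftrightarrow> h \<le> 1 / l" unfolding h_def support_fun_def using Z bdd by (simp add: cSUP_le_iff)
    finally show ?thesis using l by (simp add: pos_le_divide_eq mult.commute)
  qed (simp add: polar_body_def)
  have in_IK: "l *\<^sub>R \<xi> \<in> intersection_body K \<longleftrightarrow> l \<le> V" if "0 \<le> l" for l
  proof
    assume "l *\<^sub>R \<xi> \<in> intersection_body K"
    then obtain m \<zeta> where m: "l *\<^sub>R \<xi> = m *\<^sub>R \<zeta>" "norm \<zeta> = 1" "0 \<le> m" "m \<le> section_volume K {y. \<zeta> \<bullet> y = 0}"
      by (auto simp: intersection_body_def)
    then have "l = m" using \<xi> that by (metis abs_of_nonneg mult.right_neutral norm_scaleR)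
    then show "l \<le> V" using m V by (cases "l = 0") (auto simp: V_def)
  next
    assume "l \<le> V"
    then show "l *\<^sub>R \<xi> \<in> intersection_body K" using \<xi> that by (auto simp: intersection_body_def V_def)
  qed
  have iff: "l * h \<le> 1 \<longleftrightarrow> l \<le> V" if "0 \<le> l" for l
    using in_polar[OF that] in_IK[OF that] polar by simp
  have "0 < h"
  proof (rule ccontr)
    assume "\<not> 0 < h"
    then have "(V + 1) * h \<le> 1" using V by (smt (verit) mult_nonneg_nonpos)
    then show False using iff[of "V + 1"] V by simp
  qed
  then have "1 / h \<le> V" "V * h \<le> 1" using iff[of "1 / h"] iff[of V] V by simp_all
  with \<open>0 < h\<close> show ?thesis unfolding V_def[symmetric] h_def[symmetric]
    by (simp add: pos_divide_le_eq mult.commute)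
qed

section \<open>Averaging the support function over the equator\<close>

context revolution_body
begin

lemma P_nonneg:
  assumes "x \<le> 1"
  shows "0 \<le> P x"
  unfolding P_def
proof (cases "0 < x")
  case True
  show "0 \<le> integral {0..x} (\<lambda>t. (1 - t\<^sup>2 / x\<^sup>2) * \<rho> t ^ 5)"
  proof (rule integral_nonneg)
    show "(\<lambda>t. (1 - t\<^sup>2 / x\<^sup>2) * \<rho> t ^ 5) integrable_on {0..x}"
      using assms True by (intro integrable_profile continuous_intros) auto
    fix t assume t: "t \<in> {0..x}"
    then have "0 < \<rho> t" using assms profile_ext_pos[of t] by (simp add: profile_ext_eq)
    moreover have "t\<^sup>2 / x\<^sup>2 \<le> 1" using t True by (simp add: power_mono)
    ultimately show "0 \<le> (1 - t\<^sup>2 / x\<^sup>2) * \<rho> t ^ 5" by simp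
  qed
next
  case False
  then show "0 \<le> integral {0..x} (\<lambda>t. (1 - t\<^sup>2 / x\<^sup>2) * \<rho> t ^ 5)"
    by (cases "x = 0") auto
qed

text \<open>Normalizing \<open>e + z *\<^sub>R axis 6 1\<close> multiplies the integral by
  \<open>x\<close>, while the section volume carries the factor \<open>1 / x\<close>. These cancel,
  which leaves the reciprocal of \<open>P\<close> up to a constant.\<close>

lemma support_integral:
  fixes \<mu> :: "(real^6) measure"
  assumes Z: "compact Z" "Z \<noteq> {}" and polar: "intersection_body K = polar_body Z"
    and \<mu>: "\<And>u. u \<in> sphere 0 1 \<Longrightarrow> support_fun Z u = (\<integral>v. \<bar>u \<bullet> v\<bar> \<partial>\<mu>)"
    and e: "norm e = 1" "e $ 6 = 0" and z: "0 < z"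
  shows "(\<integral>v. \<bar>(e + z *\<^sub>R axis 6 1) \<bullet> v\<bar> \<partial>\<mu>) = 1 / (2 * norm_mass * P (1 / sqrt (1 + z\<^sup>2)))"
proof -
  define x where "x = 1 / sqrt (1 + z\<^sup>2)"
  have pos: "0 < 1 + z\<^sup>2" by (simp add: add_pos_nonneg)
  then have x: "0 < x" "x\<^sup>2 * (1 + z\<^sup>2) = 1" by (simp_all add: x_def power_divide)
  define \<xi> where "\<xi> = x *\<^sub>R (e + z *\<^sub>R axis 6 1)"
  have "e \<bullet> e = 1" using e by (simp add: norm_eq_1)
  then have "\<xi> \<bullet> \<xi> = x\<^sup>2 * (1 + z\<^sup>2)"
    using e by (simp add: \<xi>_def inner_add_left inner_add_right inner_axis inner_axis' power2_eq_square algebra_simps)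
  then have \<xi>: "norm \<xi> = 1" using x by (simp add: norm_eq_1)
  have \<xi>6: "\<xi> $ 6 = x * z" using e by (simp add: \<xi>_def)
  have V: "section_volume K {y. \<xi> \<bullet> y = 0} = 2 * norm_mass * P x / x"
    by (rule section_volume_eq_P[OF \<xi> x(1)]) (use x(2) in \<open>simp add: \<xi>6 power_mult_distrib algebra_simps\<close>)
  have "support_fun Z \<xi> = (\<integral>v. \<bar>\<xi> \<bullet> v\<bar> \<partial>\<mu>)" using \<mu> \<xi> by simp
  also have "\<dots> = x * (\<integral>v. \<bar>(e + z *\<^sub>R axis 6 1) \<bullet> v\<bar> \<partial>\<mu>)"
    using x(1) by (simp add: \<xi>_def abs_mult)
  finally have "x * (\<integral>v. \<bar>(e + z *\<^sub>R axis 6 1) \<bullet> v\<bar> \<partial>\<mu>) * (2 * norm_mass * P x / x) = 1"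
    using support_fun_mult_section_volume[OF Z polar \<xi>] V by simp
  then have "(\<integral>v. \<bar>(e + z *\<^sub>R axis 6 1) \<bullet> v\<bar> \<partial>\<mu>) * (2 * norm_mass * P x) = 1"
    using x(1) by simp
  \<comment> \<open>That the product is 1 also shows that the divisor is nonzero.\<close>
  then show ?thesis unfolding x_def[symmetric] by (metis mult_eq_0_iff nonzero_eq_divide_eq zero_neq_one)
qed

text \<open>By \<open>support_integral\<close> the value is the same for every equatorial direction,
  so the identity is integrated over \<open>Y\<close> in the unit ball of \<open>real^5\<close> with
  direction \<open>\<phi> Y / norm Y\<close>. Tonelli's theorem and \<open>nn_integral_zonal\<close>
  with constant radius 1 turn the integrand into \<open>zonal_kernel\<close>. The measure
  \<open>m\<close> is the image of the zonoid measure under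
  \<open>v \<mapsto> \<bar>v $ 6\<bar>\<close>.\<close>

lemma polar_zonoid_zonal_representation:
  assumes "polar_zonoid (intersection_body K)"
  obtains m :: "real measure" and C where "0 < C" "sets m = sets borel" "finite_measure m"
    "AE \<beta> in m. 0 \<le> \<beta> \<and> \<beta> \<le> 1"
    "\<And>z. 0 < z \<Longrightarrow> integrable m (\<lambda>\<beta>. zonal_kernel (sqrt (1 - \<beta>\<^sup>2)) (z * \<beta>))"
    "\<And>z. 0 < z \<Longrightarrow> C / P (1 / sqrt (1 + z\<^sup>2)) = (\<integral>\<beta>. zonal_kernel (sqrt (1 - \<beta>\<^sup>2)) (z * \<beta>) \<partial>m)"
proof -
  obtain Z and \<mu> :: "(real^6) measure" where Z: "compact Z" "Z \<noteq> {}" and polar: "intersection_body K = polar_body Z"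
    and sets_\<mu>: "sets \<mu> = sets (restrict_space borel (sphere 0 1))" and fin_\<mu>: "finite_measure \<mu>"
    and \<mu>: "\<And>u. u \<in> sphere 0 1 \<Longrightarrow> support_fun Z u = (\<integral>v. \<bar>u \<bullet> v\<bar> \<partial>\<mu>)"
    using assms unfolding polar_zonoid_def zonoid_def by blast
  have space_\<mu>: "space \<mu> = sphere 0 1" using sets_eq_imp_space_eq[OF sets_\<mu>] by (simp add: space_restrict_space)
  have id_\<mu>: "(\<lambda>v. v) \<in> measurable \<mu> borel"
    using sets_\<mu> by (simp add: measurable_restrict_space1 cong: measurable_cong_sets)
  \<comment> \<open>\<mu> has the sphere as its space; \<nu> is the same mass viewed as a Borel
    measure on all of \<open>real^6\<close>.\<close>
  define \<nu> where "\<nu> = distr \<mu> borel (\<lambda>v. v)"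
  have [simp, measurable_cong]: "sets \<nu> = sets borel" by (simp add: \<nu>_def)
  have "finite_measure \<nu>" unfolding \<nu>_def using fin_\<mu> id_\<mu> by (rule finite_measure.finite_measure_distr)
  then interpret \<nu>: finite_measure \<nu> .
  interpret lborel_\<nu>: pair_sigma_finite "lborel :: (real^5) measure" \<nu> ..
  have AE_\<nu>: "AE v in \<nu>. norm v = 1"
    unfolding \<nu>_def by (subst AE_distr_iff[OF id_\<mu>]) (auto simp: space_\<mu> intro!: AE_I2)
  have "(axis 6 1 :: real^6) \<noteq> 0" by simp
  then obtain \<phi> where \<phi>: "isometric_param {x. axis 6 1 \<bullet> x = 0} \<phi>" using isometric_param_exists by blast
  have lin: "linear \<phi>" and n\<phi>: "\<And>Y. norm (\<phi> Y) = norm Y" and \<phi>6: "\<phi> Y $ 6 = 0" for Y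
    using \<phi> by (auto simp: isometric_param_def inner_axis')
  have [measurable]: "\<phi> \<in> borel_measurable borel"
    using lin by (intro borel_measurable_continuous_onI) (simp add: linear_continuous_on linear_linear)
  define m where "m = distr \<nu> borel (\<lambda>v. \<bar>v $ 6\<bar>)"
  have abs6: "(\<lambda>v. \<bar>v $ 6\<bar>) \<in> measurable \<nu> borel" by measurable
  define vol where "vol = measure lborel (cball 0 1 :: (real^5) set)"
  have vol: "0 < vol" "emeasure lborel (cball 0 1 :: (real^5) set) = ennreal vol"
    using content_cball_pos[of 1 "0::real^5"] emeasure_bounded_finite[of "cball 0 1 :: (real^5) set"]
    by (simp_all add: vol_def emeasure_eq_ennreal_measure)
  \<comment> \<open>The factor \<open>vol\<close> comes from integrating the constant
    \<open>D\<close> over the ball, one \<open>norm_mass\<close> from the section volume inside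
    \<open>D\<close>, the other from \<open>nn_integral_zonal\<close>.\<close>
  define C where "C = vol / (2 * norm_mass\<^sup>2)"
  have C: "0 < C" using vol norm_mass by (simp add: C_def)
  have sets_m: "sets m = sets borel" by (simp add: m_def)
  have fin_m: "finite_measure m" unfolding m_def by (rule \<nu>.finite_measure_distr[OF abs6])
  have AE_m: "AE \<beta> in m. 0 \<le> \<beta> \<and> \<beta> \<le> 1"
    unfolding m_def
    by (subst AE_distr_iff[OF abs6]) (use AE_\<nu> in \<open>auto elim!: eventually_mono intro: order_trans[OF component_le_norm_cart]\<close>)
  have main: "(\<integral>\<^sup>+\<beta>. ennreal (zonal_kernel (sqrt (1 - \<beta>\<^sup>2)) (z * \<beta>)) \<partial>m) = ennreal (C / P (1 / sqrt (1 + z\<^sup>2)))"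
    if z: "0 < z" for z
  proof -
    define D where "D = 1 / (2 * norm_mass * P (1 / sqrt (1 + z\<^sup>2)))"
    define G where "G Y v = ennreal \<bar>\<phi> Y \<bullet> v / norm Y + z * (v \<bullet> axis 6 1)\<bar>" for Y v
    have [measurable]: "cball 0 1 \<in> sets (borel :: (real^5) measure)" by (simp add: borel_closed)
    have G_meas [measurable]: "(\<lambda>(Y, v). G Y v * indicator (cball 0 1) Y) \<in> borel_measurable (lborel \<Otimes>\<^sub>M \<nu>)"
      unfolding G_def by measurable
    have inner: "(\<integral>\<^sup>+v. G Y v \<partial>\<nu>) = ennreal D" if "Y \<noteq> 0" for Y
    proof -
      define e where "e = \<phi> Y /\<^sub>R norm Y"
      have e: "norm e = 1" "e $ 6 = 0" using that by (simp_all add: e_def n\<phi> \<phi>6)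
      have [measurable]: "(\<lambda>v. \<bar>(e + z *\<^sub>R axis 6 1) \<bullet> v\<bar>) \<in> borel_measurable borel" by simp
      have int: "integrable \<nu> (\<lambda>v. \<bar>(e + z *\<^sub>R axis 6 1) \<bullet> v\<bar>)"
      proof (rule \<nu>.integrable_const_bound)
        show "AE v in \<nu>. norm \<bar>(e + z *\<^sub>R axis 6 1) \<bullet> v\<bar> \<le> norm (e + z *\<^sub>R axis 6 1)"
          using AE_\<nu> by eventually_elim (use Cauchy_Schwarz_ineq2 in \<open>metis abs_abs mult.right_neutral real_norm_def\<close>)
      qed simp
      have "(\<integral>\<^sup>+v. G Y v \<partial>\<nu>) = (\<integral>\<^sup>+v. ennreal \<bar>(e + z *\<^sub>R axis 6 1) \<bullet> v\<bar> \<partial>\<nu>)"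
        by (intro nn_integral_cong) (simp add: G_def e_def inner_add_left inner_axis inner_axis' divide_inverse_commute)
      also have "\<dots> = ennreal (\<integral>v. \<bar>(e + z *\<^sub>R axis 6 1) \<bullet> v\<bar> \<partial>\<nu>)"
        using int by (rule nn_integral_eq_integral) simp
      also have "(\<integral>v. \<bar>(e + z *\<^sub>R axis 6 1) \<bullet> v\<bar> \<partial>\<nu>) = (\<integral>v. \<bar>(e + z *\<^sub>R axis 6 1) \<bullet> v\<bar> \<partial>\<mu>)"
        unfolding \<nu>_def by (rule integral_distr[OF id_\<mu>]) simp
      also have "\<dots> = D" unfolding D_def by (rule support_integral[OF Z polar \<mu> e z])
      finally show ?thesis .
    qed
    have outer: "(\<integral>\<^sup>+Y. G Y v * indicator (cball 0 1) Y \<partial>lborel) =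
        ennreal norm_mass * ennreal (zonal_kernel (sqrt (1 - \<bar>v $ 6\<bar>\<^sup>2)) (z * \<bar>v $ 6\<bar>))" if v: "norm v = 1" for v
    proof -
      obtain u where u: "(norm u)\<^sup>2 = (norm v)\<^sup>2 - (v \<bullet> axis 6 1)\<^sup>2" "\<And>Y. \<phi> Y \<bullet> v = Y \<bullet> u"
        using isometric_param_inner[OF \<phi>] norm_axis_1 by blast
      define \<alpha> where "\<alpha> = sqrt (1 - \<bar>v $ 6\<bar>\<^sup>2)"
      have "(norm u)\<^sup>2 = 1 - \<bar>v $ 6\<bar>\<^sup>2" using u(1) v by (simp add: inner_axis)
      then have nu: "norm u = \<alpha>" unfolding \<alpha>_def by (metis norm_ge_zero real_sqrt_unique)
      then have \<alpha>: "0 \<le> \<alpha>" by (metis norm_ge_zero)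
      \<comment> \<open>If \<open>u = 0\<close> then \<alpha> is 0, and any unit vector can serve as
        \<open>p\<close>.\<close>
      obtain p where p: "norm p = 1" "u = \<alpha> *\<^sub>R p"
      proof (cases "u = 0")
        case True
        then show ?thesis using that[of "axis 1 1"] nu by (simp add: norm_axis_1)
      next
        case False
        then show ?thesis using that[of "u /\<^sub>R norm u"] nu by auto
      qed
      have "(\<integral>\<^sup>+Y. G Y v * indicator (cball 0 1) Y \<partial>lborel) =
        (\<integral>\<^sup>+Y. (\<lambda>t. ennreal \<bar>\<alpha> * t + z * (v $ 6)\<bar>) (Y \<bullet> p / norm Y) * indicator {Y. norm Y \<le> (\<lambda>_. 1) (Y \<bullet> p / norm Y)} Y \<partial>lborel)"
        by (intro nn_integral_cong) (simp add: G_def u(2) p(2) indicator_def inner_axis)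
      also have "\<dots> = ennreal norm_mass * (\<integral>\<^sup>+t. ennreal \<bar>\<alpha> * t + z * (v $ 6)\<bar> * ennreal ((1 - t\<^sup>2) * 1 ^ 5) * indicator {-1<..<1} t \<partial>lborel)"
        by (subst nn_integral_zonal[OF p(1)]) (simp_all add: norm_mass)
      also have "\<dots> = ennreal norm_mass * ennreal (zonal_kernel \<alpha> \<bar>z * (v $ 6)\<bar>)"
        using nn_integral_zonal_kernel[OF \<alpha>] by simp
      finally show ?thesis using z by (simp add: \<alpha>_def abs_mult)
    qed
    have kernel_meas [measurable]: "(\<lambda>\<beta>. zonal_kernel (sqrt (1 - \<beta>\<^sup>2)) (z * \<beta>)) \<in> borel_measurable borel"
      unfolding zonal_kernel_def by measurable
    have "ennreal D * ennreal vol = (\<integral>\<^sup>+Y. ennreal D * indicator (cball 0 1) (Y :: real^5) \<partial>lborel)"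
      by (simp add: nn_integral_cmult vol borel_closed)
    also have "\<dots> = (\<integral>\<^sup>+Y. \<integral>\<^sup>+v. G Y v * indicator (cball 0 1) Y \<partial>\<nu> \<partial>lborel)"
    proof (rule nn_integral_cong_AE)
      show "AE Y in lborel. ennreal D * indicator (cball 0 1) (Y :: real^5) = (\<integral>\<^sup>+v. G Y v * indicator (cball 0 1) Y \<partial>\<nu>)"
        using AE_lborel_singleton[of 0] by eventually_elim (simp add: inner indicator_def)
    qed
    also have "\<dots> = (\<integral>\<^sup>+v. \<integral>\<^sup>+Y. G Y v * indicator (cball 0 1) Y \<partial>lborel \<partial>\<nu>)"
      by (rule lborel_\<nu>.Fubini'[symmetric, OF G_meas])
    also have "\<dots> = (\<integral>\<^sup>+v. ennreal norm_mass * ennreal (zonal_kernel (sqrt (1 - \<bar>v $ 6\<bar>\<^sup>2)) (z * \<bar>v $ 6\<bar>)) \<partial>\<nu>)"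
    proof (rule nn_integral_cong_AE)
      show "AE v in \<nu>. (\<integral>\<^sup>+Y. G Y v * indicator (cball 0 1) Y \<partial>lborel) =
          ennreal norm_mass * ennreal (zonal_kernel (sqrt (1 - \<bar>v $ 6\<bar>\<^sup>2)) (z * \<bar>v $ 6\<bar>))"
        using AE_\<nu> by eventually_elim (rule outer)
    qed
    also have "\<dots> = (\<integral>\<^sup>+\<beta>. ennreal norm_mass * ennreal (zonal_kernel (sqrt (1 - \<beta>\<^sup>2)) (z * \<beta>)) \<partial>m)"
      unfolding m_def by (rule nn_integral_distr[OF abs6, symmetric]) simp
    also have "\<dots> = ennreal norm_mass * (\<integral>\<^sup>+\<beta>. ennreal (zonal_kernel (sqrt (1 - \<beta>\<^sup>2)) (z * \<beta>)) \<partial>m)"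
      by (rule nn_integral_cmult) (simp add: sets_m cong: measurable_cong_sets)
    finally have eq: "ennreal norm_mass * (\<integral>\<^sup>+\<beta>. ennreal (zonal_kernel (sqrt (1 - \<beta>\<^sup>2)) (z * \<beta>)) \<partial>m) = ennreal D * ennreal vol" ..
    have "(\<integral>\<^sup>+\<beta>. ennreal (zonal_kernel (sqrt (1 - \<beta>\<^sup>2)) (z * \<beta>)) \<partial>m) =
      ennreal (1 / norm_mass) * (ennreal norm_mass * (\<integral>\<^sup>+\<beta>. ennreal (zonal_kernel (sqrt (1 - \<beta>\<^sup>2)) (z * \<beta>)) \<partial>m))"
      using norm_mass(2) by (simp add: mult.assoc[symmetric] flip: ennreal_mult')
    also have "\<dots> = ennreal (1 / norm_mass * (D * vol))"
      unfolding eq using vol(1) norm_mass(2) by (subst ennreal_mult', simp, subst ennreal_mult'') simp_all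
    also have "1 / norm_mass * (D * vol) = C / P (1 / sqrt (1 + z\<^sup>2))"
      by (simp add: C_def D_def power2_eq_square)
    finally show ?thesis .
  qed
  have kernel_meas: "(\<lambda>\<beta>. zonal_kernel (sqrt (1 - \<beta>\<^sup>2)) (z * \<beta>)) \<in> borel_measurable m" for z
    unfolding zonal_kernel_def using sets_m by (simp cong: measurable_cong_sets)
  have nonneg: "AE \<beta> in m. 0 \<le> zonal_kernel (sqrt (1 - \<beta>\<^sup>2)) (z * \<beta>)" if "0 < z" for z
    using AE_m
  proof eventually_elim
    case (elim \<beta>)
    then show ?case using zonal_kernel_nonneg[of "sqrt (1 - \<beta>\<^sup>2)" "z * \<beta>"] that
      by (simp add: abs_mult abs_square_le_1)
  qed
  have int: "integrable m (\<lambda>\<beta>. zonal_kernel (sqrt (1 - \<beta>\<^sup>2)) (z * \<beta>))" if "0 < z" for z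
    by (rule integrableI_nonneg[OF kernel_meas nonneg[OF that]]) (simp add: main[OF that])
  have "C / P (1 / sqrt (1 + z\<^sup>2)) = (\<integral>\<beta>. zonal_kernel (sqrt (1 - \<beta>\<^sup>2)) (z * \<beta>) \<partial>m)" if z: "0 < z" for z
  proof -
    have "ennreal (\<integral>\<beta>. zonal_kernel (sqrt (1 - \<beta>\<^sup>2)) (z * \<beta>) \<partial>m) = ennreal (C / P (1 / sqrt (1 + z\<^sup>2)))"
      using nn_integral_eq_integral[OF int[OF z] nonneg[OF z]] main[OF z] by simp
    moreover have "0 \<le> C / P (1 / sqrt (1 + z\<^sup>2))"
    proof -
      have "1 \<le> sqrt (1 + z\<^sup>2)" by simp
      then have "1 / sqrt (1 + z\<^sup>2) \<le> 1" by (intro divide_le_eq_1_pos[THEN iffD2]) (auto simp: add_pos_nonneg)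
      then show ?thesis using C P_nonneg by (intro divide_nonneg_nonneg) auto
    qed
    ultimately show ?thesis
      using integral_nonneg_AE[OF nonneg[OF z]] by (subst (asm) ennreal_inj) simp_all
  qed
  then show ?thesis using that C sets_m fin_m AE_m int by blast
qed

end

section \<open>Convexity of the second derivative\<close>

lemma has_real_derivative_pos_part_power:
  "((\<lambda>u. max 0 u ^ (n + 2)) has_real_derivative real (n + 2) * max 0 u ^ (n + 1)) (at u)"
proof -
  consider "u < 0" | "u = 0" | "0 < u" by linarith
  then show ?thesis
  proof cases
    case 1
    have "((\<lambda>_. 0) has_real_derivative 0) (at u)" by simp
    then have "((\<lambda>u. max 0 u ^ (n + 2)) has_real_derivative 0) (at u)"
      by (rule has_field_derivative_transform_within_open[where S = "{..<0}"]) (use 1 in auto)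
    then show ?thesis using 1 by simp
  next
    case 3
    have "((\<lambda>u. u ^ (n + 2)) has_real_derivative real (n + 2) * u ^ (n + 1)) (at u)"
      using DERIV_pow[of "n + 2" u] by simp
    then have "((\<lambda>u. max 0 u ^ (n + 2)) has_real_derivative real (n + 2) * u ^ (n + 1)) (at u)"
      by (rule has_field_derivative_transform_within_open[where S = "{0<..}"]) (use 3 in auto)
    then show ?thesis using 3 by simp
  next
    case 2
    \<comment> \<open>At the kink the difference quotient is bounded by
      \<open>\<bar>h\<bar> ^ (n + 1)\<close>, which tends to 0; this is why the exponent is at least
      2.\<close>
    have "((\<lambda>h. (max 0 (0 + h) ^ (n + 2) - max 0 0 ^ (n + 2)) / h) \<longlongrightarrow> 0) (at (0::real))"
    proof (rule Lim_null_comparison)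
      show "\<forall>\<^sub>F h in at (0::real). norm ((max 0 (0 + h) ^ (n + 2) - max 0 0 ^ (n + 2)) / h) \<le> \<bar>h\<bar> ^ (n + 1)"
      proof (rule always_eventually, rule allI)
        fix h :: real
        show "norm ((max 0 (0 + h) ^ (n + 2) - max 0 0 ^ (n + 2)) / h) \<le> \<bar>h\<bar> ^ (n + 1)"
        proof (cases "0 < h")
          case False
          then have "norm ((max 0 (0 + h) ^ (n + 2) - max 0 0 ^ (n + 2)) / h) = 0" by simp
          also have "0 \<le> \<bar>h\<bar> ^ (n + 1)" by (rule zero_le_power) simp
          finally show ?thesis .
        qed simp
      qed
      have "((\<lambda>h::real. \<bar>h\<bar> ^ (n + 1)) \<longlongrightarrow> \<bar>0\<bar> ^ (n + 1)) (at 0)" by (intro tendsto_intros)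
      then show "((\<lambda>h::real. \<bar>h\<bar> ^ (n + 1)) \<longlongrightarrow> 0) (at 0)" by simp
    qed
    then have "((\<lambda>u. max 0 u ^ (n + 2)) has_real_derivative 0) (at 0)"
      unfolding DERIV_def .
    then show ?thesis using 2 by simp
  qed
qed

text \<open>The product \<open>\<beta> / \<alpha> * \<alpha>\<close> is left uncancelled: it is
  \<beta> for nonzero \<alpha>, but 0 for \<open>\<alpha> = 0\<close>, where the kernel is the
  linear function \<open>4/3 * (z * \<beta>)\<close>.\<close>

definition zonal_kernel' :: "real \<Rightarrow> real \<Rightarrow> real \<Rightarrow> real" where
  "zonal_kernel' \<alpha> \<beta> z = 4/3 * \<beta> - \<beta> / \<alpha> * \<alpha> * (2 * max 0 (1 - z * (\<beta> / \<alpha>)) ^ 2 - 2/3 * max 0 (1 - z * (\<beta> / \<alpha>)) ^ 3)"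

text \<open>For positive \<alpha> this is \<open>2 * \<beta>\<^sup>2 / \<alpha>\<close> times the
  positive part of the weight \<open>1 - a\<^sup>2\<close> at the zero
  \<open>a = - z * \<beta> / \<alpha>\<close> of \<open>a * \<alpha> + z * \<beta>\<close>, in
  accordance with the second derivative of an absolute value being twice a point mass.\<close>

definition zonal_kernel'' :: "real \<Rightarrow> real \<Rightarrow> real \<Rightarrow> real" where
  "zonal_kernel'' \<alpha> \<beta> z = 2 * \<alpha> * (\<beta> / \<alpha>)\<^sup>2 * max 0 (1 - z\<^sup>2 * (\<beta> / \<alpha>)\<^sup>2)"

lemma zonal_kernel_deriv:
  "((\<lambda>z. zonal_kernel \<alpha> (z * \<beta>)) has_real_derivative zonal_kernel' \<alpha> \<beta> z) (at z)"
proof -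
  define q where "q = \<beta> / \<alpha>"
  have u: "((\<lambda>z. 1 - z * q) has_real_derivative - q) (at z)" by (auto intro!: derivative_eq_intros)
  have "((\<lambda>z. 4/3 * (z * \<beta>) + \<alpha> * (2/3 * max 0 (1 - z * q) ^ (1 + 2) - max 0 (1 - z * q) ^ (2 + 2) / 6)) has_real_derivative
     4/3 * \<beta> + \<alpha> * (2/3 * (real (1 + 2) * max 0 (1 - z * q) ^ (1 + 1) * - q) - real (2 + 2) * max 0 (1 - z * q) ^ (2 + 1) * - q / 6)) (at z)"
    by (intro DERIV_add DERIV_cmult DERIV_diff DERIV_cdivide DERIV_chain2[OF has_real_derivative_pos_part_power u])
       (auto intro!: derivative_eq_intros)
  moreover have "4/3 * \<beta> + \<alpha> * (2/3 * (real (1 + 2) * max 0 (1 - z * q) ^ (1 + 1) * - q) - real (2 + 2) * max 0 (1 - z * q) ^ (2 + 1) * - q / 6) =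
     zonal_kernel' \<alpha> \<beta> z"
    unfolding zonal_kernel'_def q_def[symmetric] by (simp add: power2_eq_square power3_eq_cube algebra_simps)
  moreover have "(\<lambda>z. 4/3 * (z * \<beta>) + \<alpha> * (2/3 * max 0 (1 - z * q) ^ (1 + 2) - max 0 (1 - z * q) ^ (2 + 2) / 6)) =
     (\<lambda>z. zonal_kernel \<alpha> (z * \<beta>))"
    by (simp add: zonal_kernel_def q_def power3_eq_cube mult.assoc)
  ultimately show ?thesis by metis
qed

lemma zonal_kernel'_deriv:
  assumes "0 \<le> \<alpha>" "0 \<le> \<beta>" "0 \<le> z"
  shows "((\<lambda>z. zonal_kernel' \<alpha> \<beta> z) has_real_derivative zonal_kernel'' \<alpha> \<beta> z) (at z)"
proof -
  define q where "q = \<beta> / \<alpha>"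
  have q: "0 \<le> z * q" using assms by (simp add: q_def)
  have u: "((\<lambda>z. 1 - z * q) has_real_derivative - q) (at z)" by (auto intro!: derivative_eq_intros)
  have "((\<lambda>z. 4/3 * \<beta> - q * \<alpha> * (2 * max 0 (1 - z * q) ^ (0 + 2) - 2/3 * max 0 (1 - z * q) ^ (1 + 2))) has_real_derivative
     0 - q * \<alpha> * (2 * (real (0 + 2) * max 0 (1 - z * q) ^ (0 + 1) * - q) - 2/3 * (real (1 + 2) * max 0 (1 - z * q) ^ (1 + 1) * - q))) (at z)"
    by (intro DERIV_const DERIV_cmult DERIV_diff DERIV_chain2[OF has_real_derivative_pos_part_power u])
  moreover have "0 - q * \<alpha> * (2 * (real (0 + 2) * max 0 (1 - z * q) ^ (0 + 1) * - q) - 2/3 * (real (1 + 2) * max 0 (1 - z * q) ^ (1 + 1) * - q)) =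
     2 * \<alpha> * q\<^sup>2 * (max 0 (1 - z * q) * (2 - max 0 (1 - z * q)))"
    by (simp add: power2_eq_square algebra_simps)
  \<comment> \<open>With u = 1 - z q one has u (2 - u) = 1 - (z q)(z q), and since z q is
    nonnegative both positive parts vanish exactly when z q is at least 1.\<close>
  moreover have "max 0 (1 - z * q) * (2 - max 0 (1 - z * q)) = max 0 (1 - z\<^sup>2 * q\<^sup>2)"
  proof (cases "z * q \<le> 1")
    case True
    moreover have "(z * q)\<^sup>2 \<le> 1" using True q by (simp add: abs_square_le_1)
    ultimately show ?thesis by (simp add: power_mult_distrib power2_eq_square algebra_simps)
  next
    case False
    then have "1 \<le> (z * q)\<^sup>2" by (simp add: one_le_power)
    then show ?thesis using False by (simp add: power_mult_distrib)
  qed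
  moreover have "(\<lambda>z. 4/3 * \<beta> - q * \<alpha> * (2 * max 0 (1 - z * q) ^ (0 + 2) - 2/3 * max 0 (1 - z * q) ^ (1 + 2))) = zonal_kernel' \<alpha> \<beta>"
    by (simp add: zonal_kernel'_def q_def fun_eq_iff power2_eq_square power3_eq_cube)
  ultimately show ?thesis by (simp add: zonal_kernel''_def q_def)
qed

lemma zonal_kernel''_nonneg: "0 \<le> \<alpha> \<Longrightarrow> 0 \<le> zonal_kernel'' \<alpha> \<beta> z"
  by (simp add: zonal_kernel''_def)

text \<open>The bound is independent of \<beta> and so supplies the constant for dominated
  convergence. Wherever the positive part is nonzero, \<open>(\<beta> / \<alpha>)\<^sup>2\<close> is
  at most \<open>1 / z\<^sup>2\<close>.\<close>

lemma zonal_kernel''_le: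
  assumes "0 \<le> \<alpha>" "\<alpha> \<le> 1" "0 < z"
  shows "zonal_kernel'' \<alpha> \<beta> z \<le> 2 / z\<^sup>2"
proof (cases "z\<^sup>2 * (\<beta> / \<alpha>)\<^sup>2 \<le> 1")
  case True
  have "\<alpha> * ((\<beta> / \<alpha>)\<^sup>2 * (1 - z\<^sup>2 * (\<beta> / \<alpha>)\<^sup>2)) \<le> 1 * ((\<beta> / \<alpha>)\<^sup>2 * 1)"
    using assms True by (intro mult_mono) auto
  also have "\<dots> \<le> 1 / z\<^sup>2" using True assms by (simp add: pos_le_divide_eq mult.commute)
  finally show ?thesis using True by (simp add: zonal_kernel''_def mult.assoc)
qed (simp add: zonal_kernel''_def)

section \<open>Differentiating the zonal representation twice\<close>

lemma second_difference_mvt: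
  fixes f :: "real \<Rightarrow> real"
  assumes e: "0 < e"
    and f: "\<And>t. \<bar>t - z\<bar> \<le> e \<Longrightarrow> (f has_real_derivative f' t) (at t)"
    and f': "\<And>t. \<bar>t - z\<bar> \<le> e \<Longrightarrow> (f' has_real_derivative f'' t) (at t)"
  obtains \<zeta> where "\<bar>\<zeta> - z\<bar> \<le> e" "(f (z + e) - 2 * f z + f (z - e)) / e\<^sup>2 = f'' \<zeta>"
proof -
  \<comment> \<open>The mean value theorem is applied first to
    \<open>t \<mapsto> f (t + e) - f t\<close> between \<open>z - e\<close> and \<open>z\<close>,
    and then to \<open>f'\<close>.\<close>
  have "\<exists>\<eta>>z - e. \<eta> < z \<and> (f (z + e) - f z) - (f (z - e + e) - f (z - e)) = (z - (z - e)) * (f' (\<eta> + e) - f' \<eta>)"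
  proof (rule MVT2)
    fix t assume t: "z - e \<le> t" "t \<le> z"
    have "((\<lambda>t. f (t + e)) has_real_derivative f' (t + e)) (at t)"
      using f[of "t + e"] t e by (intro DERIV_shift[THEN iffD1]) auto
    then show "((\<lambda>t. f (t + e) - f t) has_real_derivative f' (t + e) - f' t) (at t)"
      using f[of t] t e by (intro DERIV_diff) auto
  qed (use e in simp)
  then obtain \<eta> where \<eta>: "z - e < \<eta>" "\<eta> < z" "f (z + e) - 2 * f z + f (z - e) = e * (f' (\<eta> + e) - f' \<eta>)"
    by auto
  have "\<exists>\<zeta>>\<eta>. \<zeta> < \<eta> + e \<and> f' (\<eta> + e) - f' \<eta> = (\<eta> + e - \<eta>) * f'' \<zeta>"
    using \<eta> e by (intro MVT2 f') auto
  then obtain \<zeta> where "\<eta> < \<zeta>" "\<zeta> < \<eta> + e" "f' (\<eta> + e) - f' \<eta> = e * f'' \<zeta>" by auto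
  then show ?thesis using \<eta> e by (intro that[of \<zeta>]) (auto simp: power2_eq_square)
qed

lemma second_difference_tendsto:
  fixes f :: "real \<Rightarrow> real"
  assumes e: "\<And>n. 0 < e n" "\<And>n. e n \<le> d" "e \<longlonglongrightarrow> 0"
    and f: "\<And>t. \<bar>t - z\<bar> \<le> d \<Longrightarrow> (f has_real_derivative f' t) (at t)"
    and f': "\<And>t. \<bar>t - z\<bar> \<le> d \<Longrightarrow> (f' has_real_derivative f'' t) (at t)"
    and f'': "isCont f'' z"
  shows "(\<lambda>n. (f (z + e n) - 2 * f z + f (z - e n)) / (e n)\<^sup>2) \<longlonglongrightarrow> f'' z"
proof -
  have "\<exists>\<zeta>. \<bar>\<zeta> - z\<bar> \<le> e n \<and> (f (z + e n) - 2 * f z + f (z - e n)) / (e n)\<^sup>2 = f'' \<zeta>" for n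
    by (rule second_difference_mvt[of "e n" z f f' f'']) (use e order_trans f f' in blast)+
  then obtain \<zeta> where \<zeta>: "\<And>n. \<bar>\<zeta> n - z\<bar> \<le> e n"
      "\<And>n. (f (z + e n) - 2 * f z + f (z - e n)) / (e n)\<^sup>2 = f'' (\<zeta> n)" by metis
  have "(\<lambda>n. \<zeta> n - z) \<longlonglongrightarrow> 0"
    by (rule Lim_null_comparison[OF _ e(3)]) (simp add: \<zeta>)
  then have "\<zeta> \<longlonglongrightarrow> z" by (simp add: LIM_zero_iff)
  then show ?thesis using isCont_tendsto_compose[OF f''] by (simp add: \<zeta>)
qed

text \<open>Symmetric second differences converge to \<open>g''\<close> on the left, since
  \<open>g\<close> is known to be twice continuously differentiable, and pass through the integral
  on the right by dominated convergence. In this way integrability of the kernel itself yields that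
  of its second derivative.\<close>

lemma zonal_representation_second_derivative:
  fixes m :: "real measure"
  assumes m: "finite_measure m" "sets m = sets borel" "AE \<beta> in m. 0 \<le> \<beta> \<and> \<beta> \<le> 1"
    and int: "\<And>z. 0 < z \<Longrightarrow> integrable m (\<lambda>\<beta>. zonal_kernel (sqrt (1 - \<beta>\<^sup>2)) (z * \<beta>))"
    and g: "\<And>z. 0 < z \<Longrightarrow> g z = (\<integral>\<beta>. zonal_kernel (sqrt (1 - \<beta>\<^sup>2)) (z * \<beta>) \<partial>m)"
    and g': "\<And>z. 0 < z \<Longrightarrow> z < \<delta> \<Longrightarrow> (g has_real_derivative g' z) (at z)"
    and g'': "\<And>z. 0 < z \<Longrightarrow> z < \<delta> \<Longrightarrow> (g' has_real_derivative g'' z) (at z)"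
    and cont: "\<And>z. 0 < z \<Longrightarrow> z < \<delta> \<Longrightarrow> isCont g'' z"
    and z: "0 < z" "z < \<delta>"
  shows "integrable m (\<lambda>\<beta>. zonal_kernel'' (sqrt (1 - \<beta>\<^sup>2)) \<beta> z)"
    and "g'' z = (\<integral>\<beta>. zonal_kernel'' (sqrt (1 - \<beta>\<^sup>2)) \<beta> z \<partial>m)"
proof -
  interpret finite_measure m by (rule m(1))
  \<comment> \<open>This choice keeps all points within \<open>d\<close> of \<open>z\<close> at or
    above \<open>z / 2\<close> and below \<delta>.\<close>
  define d where "d = min (z / 2) ((\<delta> - z) / 2)"
  have d: "0 < d" "d \<le> z / 2" "d < \<delta> - z" using z min.cobounded2[of "z / 2" "(\<delta> - z) / 2"] by (auto simp: d_def)
  define e where "e n = d / real (Suc n)" for n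
  have e: "0 < e n" "e n \<le> d" for n using d by (auto simp: e_def divide_simps)
  have e0: "e \<longlonglongrightarrow> 0"
    using tendsto_mult_left[OF LIMSEQ_inverse_real_of_nat, of d] by (simp add: e_def[abs_def] divide_inverse)
  define f where "f \<beta> z = zonal_kernel (sqrt (1 - \<beta>\<^sup>2)) (z * \<beta>)" for \<beta> z
  define k where "k \<beta> z = zonal_kernel'' (sqrt (1 - \<beta>\<^sup>2)) \<beta> z" for \<beta> z
  define D where "D n \<beta> = (f \<beta> (z + e n) - 2 * f \<beta> z + f \<beta> (z - e n)) / (e n)\<^sup>2" for n \<beta>
  have ze: "0 < z + e n" "0 < z - e n" for n using e[of n] d z by auto
  have f_deriv: "(f \<beta> has_real_derivative zonal_kernel' (sqrt (1 - \<beta>\<^sup>2)) \<beta> t) (at t)" for \<beta> t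
    unfolding f_def by (rule zonal_kernel_deriv)
  have f'_deriv: "(zonal_kernel' (sqrt (1 - \<beta>\<^sup>2)) \<beta> has_real_derivative k \<beta> t) (at t)" if "0 \<le> \<beta>" "\<beta> \<le> 1" "\<bar>t - z\<bar> \<le> d" for \<beta> t
    unfolding k_def using that d z by (intro zonal_kernel'_deriv) (auto simp: abs_square_le_1)
  have lim: "AE \<beta> in m. (\<lambda>n. D n \<beta>) \<longlonglongrightarrow> k \<beta> z"
    using m(3)
  proof eventually_elim
    case (elim \<beta>)
    have "isCont (k \<beta>) z" unfolding k_def zonal_kernel''_def by (intro continuous_intros)
    then show ?case unfolding D_def
      using elim by (intro second_difference_tendsto[OF e e0 f_deriv f'_deriv]) auto
  qed
  \<comment> \<open>Each second difference is a value of the second derivative at some \<zeta> with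
    \<open>z / 2 \<le> \<zeta>\<close>, so \<open>2 / \<zeta>\<^sup>2\<close> is at most
    \<open>8 / z\<^sup>2\<close>.\<close>
  have bound: "AE \<beta> in m. norm (D n \<beta>) \<le> 8 / z\<^sup>2" for n
    using m(3)
  proof eventually_elim
    case (elim \<beta>)
    obtain \<zeta> where \<zeta>: "\<bar>\<zeta> - z\<bar> \<le> e n" "D n \<beta> = k \<beta> \<zeta>"
      unfolding D_def using e[of n] elim
      by (rule_tac second_difference_mvt[OF e(1) f_deriv f'_deriv]) auto
    have \<zeta>z: "z / 2 \<le> \<zeta>" using \<zeta>(1) e(2)[of n] d by (auto simp: abs_le_iff)
    have \<alpha>: "0 \<le> sqrt (1 - \<beta>\<^sup>2)" "sqrt (1 - \<beta>\<^sup>2) \<le> 1" using elim by (auto simp: abs_square_le_1)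
    have "k \<beta> \<zeta> \<le> 2 / \<zeta>\<^sup>2" unfolding k_def using \<alpha> \<zeta>z z by (intro zonal_kernel''_le) auto
    also have "\<dots> \<le> 2 / (z / 2)\<^sup>2" using \<zeta>z z by (intro divide_left_mono power_mono) auto
    finally show ?case using \<zeta>(2) zonal_kernel''_nonneg[OF \<alpha>(1)] by (simp add: k_def power_divide)
  qed
  have meas: "D n \<in> borel_measurable m" "(\<lambda>\<beta>. k \<beta> z) \<in> borel_measurable m" for n
    unfolding D_def f_def k_def zonal_kernel_def zonal_kernel''_def using m(2) by (simp_all cong: measurable_cong_sets)
  have int_bound: "integrable m (\<lambda>_. 8 / z\<^sup>2)" by simp
  show "integrable m (\<lambda>\<beta>. zonal_kernel'' (sqrt (1 - \<beta>\<^sup>2)) \<beta> z)"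
    using integrable_dominated_convergence[OF meas(2) meas(1) int_bound lim bound] by (simp add: k_def)
  have "(\<lambda>n. \<integral>\<beta>. D n \<beta> \<partial>m) \<longlonglongrightarrow> (\<integral>\<beta>. k \<beta> z \<partial>m)"
    by (rule integral_dominated_convergence[OF meas(2) meas(1) int_bound lim bound])
  moreover have "(\<integral>\<beta>. D n \<beta> \<partial>m) = (g (z + e n) - 2 * g z + g (z - e n)) / (e n)\<^sup>2" for n
    unfolding D_def f_def using int[OF z(1)] int[OF ze(1), of n] int[OF ze(2), of n]
    by (simp add: g[OF z(1)] g[OF ze(1)] g[OF ze(2)])
  moreover have "(\<lambda>n. (g (z + e n) - 2 * g z + g (z - e n)) / (e n)\<^sup>2) \<longlonglongrightarrow> g'' z"
    using d z by (intro second_difference_tendsto[OF e e0, where f' = g'] g' g'' cont) (auto simp: abs_le_iff)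
  ultimately show "g'' z = (\<integral>\<beta>. zonal_kernel'' (sqrt (1 - \<beta>\<^sup>2)) \<beta> z \<partial>m)"
    using LIMSEQ_unique by (fastforce simp: k_def)
qed

section \<open>Convexity in the variable \<open>y = z\<^sup>2\<close>\<close>

lemma convex_on_zonal_kernel'':
  assumes "0 \<le> \<alpha>"
  shows "convex_on {0<..<d} (\<lambda>y. zonal_kernel'' \<alpha> \<beta> (sqrt y))"
proof (rule convex_onI)
  fix t x y :: real
  assume t: "0 < t" "t < 1" and xy: "x \<in> {0<..<d}" "y \<in> {0<..<d}"
  define a where "a = (\<beta> / \<alpha>)\<^sup>2"
  have pos: "0 < (1 - t) * x + t * y" using t xy by (intro add_pos_pos) auto
  \<comment> \<open>In the variable \<open>y\<close> the kernel is a nonnegative multiple of the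
    positive part of an affine function.\<close>
  have "max 0 (1 - ((1 - t) * x + t * y) * a) \<le> (1 - t) * max 0 (1 - x * a) + t * max 0 (1 - y * a)"
  proof (rule max.boundedI)
    show "0 \<le> (1 - t) * max 0 (1 - x * a) + t * max 0 (1 - y * a)" using t by simp
    have "1 - ((1 - t) * x + t * y) * a = (1 - t) * (1 - x * a) + t * (1 - y * a)" by (simp add: algebra_simps)
    also have "\<dots> \<le> (1 - t) * max 0 (1 - x * a) + t * max 0 (1 - y * a)"
      using t by (intro add_mono mult_left_mono) auto
    finally show "1 - ((1 - t) * x + t * y) * a \<le> (1 - t) * max 0 (1 - x * a) + t * max 0 (1 - y * a)" .
  qed
  then have "2 * \<alpha> * a * max 0 (1 - ((1 - t) * x + t * y) * a) \<le>
      2 * \<alpha> * a * ((1 - t) * max 0 (1 - x * a) + t * max 0 (1 - y * a))"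
    using assms by (intro mult_left_mono) (auto simp: a_def)
  then show "zonal_kernel'' \<alpha> \<beta> (sqrt ((1 - t) *\<^sub>R x + t *\<^sub>R y)) \<le>
      (1 - t) * zonal_kernel'' \<alpha> \<beta> (sqrt x) + t * zonal_kernel'' \<alpha> \<beta> (sqrt y)"
    using pos xy by (simp add: zonal_kernel''_def flip: a_def) (simp add: algebra_simps)
qed simp

lemma convex_on_zonal_second_derivative:
  fixes m :: "real measure"
  assumes \<delta>: "0 < \<delta>" and m: "AE \<beta> in m. 0 \<le> \<beta> \<and> \<beta> \<le> 1"
    and int: "\<And>z. 0 < z \<Longrightarrow> z < \<delta> \<Longrightarrow> integrable m (\<lambda>\<beta>. zonal_kernel'' (sqrt (1 - \<beta>\<^sup>2)) \<beta> z)"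
    and G: "\<And>z. 0 < z \<Longrightarrow> z < \<delta> \<Longrightarrow> G z = (\<integral>\<beta>. zonal_kernel'' (sqrt (1 - \<beta>\<^sup>2)) \<beta> z \<partial>m)"
  shows "convex_on {0<..<\<delta>\<^sup>2} (\<lambda>y. G (sqrt y))"
proof (rule convex_onI)
  fix t x y :: real
  assume t: "0 < t" "t < 1" and xy: "x \<in> {0<..<\<delta>\<^sup>2}" "y \<in> {0<..<\<delta>\<^sup>2}"
  let ?k = "\<lambda>\<beta> y. zonal_kernel'' (sqrt (1 - \<beta>\<^sup>2)) \<beta> (sqrt y)"
  show "G (sqrt ((1 - t) *\<^sub>R x + t *\<^sub>R y)) \<le> (1 - t) * G (sqrt x) + t * G (sqrt y)"
  proof -
    have rng: "0 < sqrt w" "sqrt w < \<delta>" if "w \<in> {0<..<\<delta>\<^sup>2}" for w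
      using that \<delta> by (auto intro: real_less_lsqrt)
    have int_xy: "integrable m (\<lambda>\<beta>. ?k \<beta> x)" "integrable m (\<lambda>\<beta>. ?k \<beta> y)"
      using xy by (auto intro!: int rng)
    have "convex {0<..<\<delta>\<^sup>2}" by simp
    then have w: "(1 - t) *\<^sub>R x + t *\<^sub>R y \<in> {0<..<\<delta>\<^sup>2}" using t xy by (intro convexD) auto
    have "(\<integral>\<beta>. ?k \<beta> ((1 - t) *\<^sub>R x + t *\<^sub>R y) \<partial>m) \<le> (\<integral>\<beta>. (1 - t) * ?k \<beta> x + t * ?k \<beta> y \<partial>m)"
    proof (rule integral_mono_AE)
      show "integrable m (\<lambda>\<beta>. ?k \<beta> ((1 - t) *\<^sub>R x + t *\<^sub>R y))" by (intro int rng w)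
      show "integrable m (\<lambda>\<beta>. (1 - t) * ?k \<beta> x + t * ?k \<beta> y)"
        by (intro Bochner_Integration.integrable_add integrable_mult_right int_xy)
      show "AE \<beta> in m. ?k \<beta> ((1 - t) *\<^sub>R x + t *\<^sub>R y) \<le> (1 - t) * ?k \<beta> x + t * ?k \<beta> y"
        using m
      proof eventually_elim
        case (elim \<beta>)
        then have "0 \<le> sqrt (1 - \<beta>\<^sup>2)" by (simp add: abs_square_le_1)
        then show ?case using convex_onD[OF convex_on_zonal_kernel'', of _ t x "\<delta>\<^sup>2" y] t xy by simp
      qed
    qed
    also have "\<dots> = (1 - t) * (\<integral>\<beta>. ?k \<beta> x \<partial>m) + t * (\<integral>\<beta>. ?k \<beta> y \<partial>m)"
      using int_xy by (simp add: Bochner_Integration.integral_add)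
    finally show ?thesis using G rng xy w by simp
  qed
qed simp

section \<open>Failure of convexity near \<open>y = 0\<close>\<close>

lemma convex_on_imp_deriv_mono:
  fixes f :: "real \<Rightarrow> real"
  assumes f: "convex_on {a<..<b} f"
    and deriv: "\<And>t. t \<in> {a<..<b} \<Longrightarrow> (f has_real_derivative f' t) (at t)"
    and xy: "x \<in> {a<..<b}" "y \<in> {a<..<b}" "x \<le> y"
  shows "f' x \<le> f' y"
proof (cases "x = y")
  case False
  have tangent: "f' s * (t - s) \<le> f t - f s" if "s \<in> {a<..<b}" "t \<in> {a<..<b}" for s t
    by (rule convex_on_imp_above_tangent[OF f])
      (use that deriv in \<open>auto simp: interior_open intro: has_field_derivative_at_within\<close>)
  \<comment> \<open>Adding the tangent inequalities at \<open>x\<close> and at \<open>y\<close>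
    eliminates the function values.\<close>
  have "f' x * (y - x) \<le> f' y * (y - x)"
    using tangent[OF xy(1,2)] tangent[OF xy(2,1)] by (simp add: algebra_simps)
  then show ?thesis using False xy(3) by simp
qed simp

text \<open>Here \<open>p\<close> stands for \<open>P\<close> as a function of \<open>y\<close>, and
  \<Phi>1, \<Phi>2, \<Phi>3 are the first three derivatives of its reciprocal. Everything at
  \<open>y = 0\<close> enters through one-sided limits; the limit 0 of \<open>T\<close> expresses
  the condition on the profile at the axis.\<close>

lemma second_derivative_not_convex:
  fixes p k q T :: "real \<Rightarrow> real"
  assumes d: "0 < d" and C: "0 < C"
    and p: "\<And>y. 0 < y \<Longrightarrow> y < d \<Longrightarrow> (p has_real_derivative - k y) (at y)"
    and k: "\<And>y. 0 < y \<Longrightarrow> y < d \<Longrightarrow> (k has_real_derivative - q y) (at y)"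
    and q: "\<And>y. 0 < y \<Longrightarrow> y < d \<Longrightarrow> (q has_real_derivative T y) (at y)"
    and lim: "(p \<longlongrightarrow> H) (at_right 0)" "(k \<longlongrightarrow> k\<^sub>0) (at_right 0)" "(q \<longlongrightarrow> r / 2) (at_right 0)" "(T \<longlongrightarrow> 0) (at_right 0)"
    and pos: "0 < H" "0 < k\<^sub>0" "2 * k\<^sub>0\<^sup>2 < H * r"
  obtains \<delta> g' g'' where "0 < \<delta>"
    "\<And>z. 0 < z \<Longrightarrow> z < \<delta> \<Longrightarrow> ((\<lambda>z. C / p (z\<^sup>2)) has_real_derivative g' z) (at z)"
    "\<And>z. 0 < z \<Longrightarrow> z < \<delta> \<Longrightarrow> (g' has_real_derivative g'' z) (at z)"
    "\<And>z. 0 < z \<Longrightarrow> z < \<delta> \<Longrightarrow> isCont g'' z"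
    "\<not> convex_on {0<..<\<delta>\<^sup>2} (\<lambda>y. g'' (sqrt y))"
proof -
  define \<Phi>1 where "\<Phi>1 y = k y / p y ^ 2" for y
  define \<Phi>2 where "\<Phi>2 y = 2 * k y ^ 2 / p y ^ 3 - q y / p y ^ 2" for y
  define \<Phi>3 where "\<Phi>3 y = 6 * k y ^ 3 / p y ^ 4 - 6 * k y * q y / p y ^ 3 - T y / p y ^ 2" for y
  have lim\<Phi>3: "(\<Phi>3 \<longlongrightarrow> 6 * k\<^sub>0 ^ 3 / H ^ 4 - 6 * k\<^sub>0 * (r / 2) / H ^ 3 - 0 / H ^ 2) (at_right 0)"
    unfolding \<Phi>3_def using pos by (intro tendsto_intros lim) auto
  have lim\<Phi>2: "(\<Phi>2 \<longlongrightarrow> 2 * k\<^sub>0 ^ 2 / H ^ 3 - (r / 2) / H ^ 2) (at_right 0)" (is "(_ \<longlongrightarrow> ?L2) _")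
    unfolding \<Phi>2_def using pos by (intro tendsto_intros lim) auto
  \<comment> \<open>The factored form shows that the limit of \<Phi>3 is negative exactly by the
    strict inequality between \<open>2 * k\<^sub>0\<^sup>2\<close> and \<open>H * r\<close>.\<close>
  have "6 * k\<^sub>0 ^ 3 / H ^ 4 - 6 * k\<^sub>0 * (r / 2) / H ^ 3 - 0 / H ^ 2 = 3 * k\<^sub>0 / H ^ 4 * (2 * k\<^sub>0\<^sup>2 - H * r)"
    using pos by (simp add: field_simps power2_eq_square power3_eq_cube power4_eq_xxxx)
  also have "\<dots> < 0" using pos by (intro mult_pos_neg) auto
  finally have "\<forall>\<^sub>F y in at_right 0. \<Phi>3 y < 0" using lim\<Phi>3 order_tendstoD(2) by blast
  moreover have "\<forall>\<^sub>F y in at_right 0. 0 < p y" using lim(1) pos(1) order_tendstoD(1) by blast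
  moreover have "\<forall>\<^sub>F y in at_right 0. y < d" using d eventually_at_right_less by (auto simp: eventually_at_right[of 0 1])
  ultimately have "\<forall>\<^sub>F y in at_right 0. \<Phi>3 y < 0 \<and> 0 < p y \<and> y < d" by eventually_elim simp
  \<comment> \<open>\<open>sqrt b\<close> will be the witness for \<delta>, so that
    \<open>z\<^sup>2\<close> ranges over the interval on which \<Phi>3 is negative and
    \<open>p\<close> is positive.\<close>
  then obtain b where b: "0 < b" "\<And>y. 0 < y \<Longrightarrow> y < b \<Longrightarrow> \<Phi>3 y < 0 \<and> 0 < p y \<and> y < d"
    by (auto simp: eventually_at_right[of 0 1])
  have d0: "((\<lambda>y. C / p y) has_real_derivative C * \<Phi>1 y) (at y)" if "0 < y" "y < b" for y
    using b(2)[OF that] that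
    by (auto intro!: derivative_eq_intros p simp: \<Phi>1_def power2_eq_square)
  have d1: "(\<Phi>1 has_real_derivative \<Phi>2 y) (at y)" if "0 < y" "y < b" for y
    unfolding \<Phi>1_def using b(2)[OF that] that
    by (auto intro!: derivative_eq_intros p k simp: \<Phi>2_def) (simp add: field_simps power2_eq_square power3_eq_cube power4_eq_xxxx)
  have d2: "(\<Phi>2 has_real_derivative \<Phi>3 y) (at y)" if "0 < y" "y < b" for y
    unfolding \<Phi>2_def using b(2)[OF that] that
    by (auto intro!: derivative_eq_intros p k q simp: \<Phi>3_def) (simp add: field_simps eval_nat_numeral)
  define g' where "g' z = C * (2 * z * \<Phi>1 (z\<^sup>2))" for z
  define g'' where "g'' z = C * (2 * \<Phi>1 (z\<^sup>2) + 4 * z\<^sup>2 * \<Phi>2 (z\<^sup>2))" for z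
  have sq: "0 < z\<^sup>2" "z\<^sup>2 < b" if "0 < z" "z < sqrt b" for z
    using that b(1) power_strict_mono[of z "sqrt b" 2] by auto
  have dsq: "((\<lambda>z. z\<^sup>2) has_real_derivative 2 * z) (at z)" for z :: real by (auto intro!: derivative_eq_intros)
  have g': "((\<lambda>z. C / p (z\<^sup>2)) has_real_derivative g' z) (at z)" if "0 < z" "z < sqrt b" for z
    using DERIV_chain2[OF d0[OF sq[OF that]] dsq] by (simp add: g'_def mult_ac)
  have g'': "(g' has_real_derivative g'' z) (at z)" if "0 < z" "z < sqrt b" for z
    unfolding g'_def
    by (rule derivative_eq_intros DERIV_chain2[OF d1[OF sq[OF that]] dsq] refl)+
      (simp add: g''_def algebra_simps power2_eq_square)
  have cont: "isCont g'' z" if "0 < z" "z < sqrt b" for z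
  proof -
    have "isCont (\<lambda>z. \<Phi>1 (z\<^sup>2)) z" "isCont (\<lambda>z. \<Phi>2 (z\<^sup>2)) z"
      using DERIV_chain2[OF d1[OF sq[OF that]] dsq] DERIV_chain2[OF d2[OF sq[OF that]] dsq]
      by (auto dest: DERIV_isCont)
    then show ?thesis unfolding g''_def by simp
  qed
  have "\<not> convex_on {0<..<(sqrt b)\<^sup>2} (\<lambda>y. g'' (sqrt y))"
  proof
    assume conv: "convex_on {0<..<(sqrt b)\<^sup>2} (\<lambda>y. g'' (sqrt y))"
    \<comment> \<open>Convexity would make \<open>N\<close> increasing, so \<open>N y\<close> would
      be at least its limit \<open>C * (6 * ?L2)\<close> at 0. But
      \<open>\<Phi>2 y \<le> ?L2\<close> and \<open>\<Phi>3 y < 0\<close> make it strictly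
      smaller.\<close>
    define N where "N y = C * (6 * \<Phi>2 y + 4 * y * \<Phi>3 y)" for y
    have N: "((\<lambda>y. g'' (sqrt y)) has_real_derivative N y) (at y)" if "y \<in> {0<..<(sqrt b)\<^sup>2}" for y
    proof -
      have y: "0 < y" "y < b" using that b(1) by auto
      have "((\<lambda>y. C * (2 * \<Phi>1 y + 4 * y * \<Phi>2 y)) has_real_derivative N y) (at y)"
        by (rule derivative_eq_intros d1[OF y] d2[OF y] refl)+ (simp add: N_def algebra_simps)
      then show ?thesis
        by (rule has_field_derivative_transform_within_open[where S = "{0<..<b}"]) (use y in \<open>auto simp: g''_def\<close>)
    qed
    define y where "y = b / 2"
    have y: "0 < y" "y < b" using b(1) by (auto simp: y_def)
    have "\<forall>\<^sub>F x in at_right 0. 6 * \<Phi>2 x + 4 * x * \<Phi>3 x \<le> 6 * \<Phi>2 y + 4 * y * \<Phi>3 y"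
    proof (rule eventually_at_rightI[of 0 y])
      fix x assume "x \<in> {0<..<y}"
      then have "N x \<le> N y" using y b(1) by (intro convex_on_imp_deriv_mono[OF conv N]) auto
      then show "6 * \<Phi>2 x + 4 * x * \<Phi>3 x \<le> 6 * \<Phi>2 y + 4 * y * \<Phi>3 y" using C by (simp add: N_def)
    qed (rule y)
    moreover have "((\<lambda>x. 6 * \<Phi>2 x + 4 * x * \<Phi>3 x) \<longlongrightarrow> 6 * ?L2 + 4 * 0 * (6 * k\<^sub>0 ^ 3 / H ^ 4 - 6 * k\<^sub>0 * (r / 2) / H ^ 3 - 0 / H ^ 2)) (at_right 0)"
      by (intro tendsto_intros lim\<Phi>2 lim\<Phi>3)
    ultimately have "6 * ?L2 + 4 * 0 * (6 * k\<^sub>0 ^ 3 / H ^ 4 - 6 * k\<^sub>0 * (r / 2) / H ^ 3 - 0 / H ^ 2) \<le> 6 * \<Phi>2 y + 4 * y * \<Phi>3 y"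
      by (intro tendsto_upperbound) auto
    \<comment> \<open>Since \<Phi>3 is negative, \<Phi>2 decreases and stays below its limit at
      0.\<close>
    moreover have "\<Phi>2 y \<le> ?L2"
    proof (rule tendsto_lowerbound[OF lim\<Phi>2])
      show "\<forall>\<^sub>F x in at_right 0. \<Phi>2 y \<le> \<Phi>2 x"
      proof (rule eventually_at_rightI[of 0 y])
        fix x assume x: "x \<in> {0<..<y}"
        show "\<Phi>2 y \<le> \<Phi>2 x"
        proof (rule DERIV_nonpos_imp_nonincreasing[of x y \<Phi>2])
          fix w assume "x \<le> w" "w \<le> y"
          then have "0 < w" "w < b" using x y by auto
          then show "\<exists>D. (\<Phi>2 has_real_derivative D) (at w) \<and> D \<le> 0" using d2 b(2) less_imp_le by blast
        qed (use x in simp)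
      qed (rule y)
    qed simp
    moreover have "4 * y * \<Phi>3 y < 0" using y b(2)[OF y] by (intro mult_pos_neg) auto
    ultimately show False by simp
  qed
  then show ?thesis using that[of "sqrt b" g' g''] b(1) g' g'' cont by simp
qed

section \<open>Derivatives of \<open>P\<close> with respect to \<open>y\<close>, and the
  conclusion\<close>

context revolution_body
begin

text \<open>For x = 1 / sqrt (1 + y) the derivative in \<open>y\<close> is - x^3 / 2. It cancels the
  denominator in the derivative 2 k / x^3 of \<open>P\<close> with respect to x, which leaves - k;
  the next steps give \<open>q\<close> = x^5 r / 2 and \<open>T\<close>. The limit of
  \<open>T\<close> is - (5 r(1) + r'(1)) / 4, a multiple of \<rho>(1) + \<rho>'(1), so
  \<open>flat\<close> makes it 0.\<close>

lemma profile_calculus: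
  assumes C2: "C2_near_1 \<rho>"
    and flat: "\<rho> 1 + vector_derivative \<rho> (at 1 within {0..1}) = 0"
  obtains d k q T where "0 < d"
    "\<And>y. 0 < y \<Longrightarrow> y < d \<Longrightarrow> ((\<lambda>y. P (1 / sqrt (1 + y))) has_real_derivative - k y) (at y)"
    "\<And>y. 0 < y \<Longrightarrow> y < d \<Longrightarrow> (k has_real_derivative - q y) (at y)"
    "\<And>y. 0 < y \<Longrightarrow> y < d \<Longrightarrow> (q has_real_derivative T y) (at y)"
    "((\<lambda>y. P (1 / sqrt (1 + y))) \<longlongrightarrow> h_fun K 1) (at_right 0)" "(k \<longlongrightarrow> k_one K) (at_right 0)"
    "(q \<longlongrightarrow> r_fun K 1 / 2) (at_right 0)" "(T \<longlongrightarrow> 0) (at_right 0)"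
proof -
  obtain \<epsilon> \<rho>' \<rho>'' where \<epsilon>: "0 < \<epsilon>" "\<epsilon> \<le> 1"
    and \<rho>': "\<And>t. t \<in> {1 - \<epsilon><..1} \<Longrightarrow> (\<rho> has_real_derivative \<rho>' t) (at t within {0..1})"
    and \<rho>'': "\<And>t. t \<in> {1 - \<epsilon><..1} \<Longrightarrow> (\<rho>' has_real_derivative \<rho>'' t) (at t within {0..1})"
    using C2 unfolding C2_near_1_def by blast
  \<comment> \<open>Derivatives relative to a nondegenerate closed interval are unique even at an
    endpoint.\<close>
  have "vector_derivative \<rho> (at 1 within {0..1}) = \<rho>' 1"
    using \<rho>'[of 1] \<epsilon>
    by (intro vector_derivative_within_closed_interval) (auto simp: has_real_derivative_iff_has_vector_derivative)
  with flat have flat': "\<rho> 1 + \<rho>' 1 = 0" by simp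
  define r where "r t = \<rho> t ^ 5" for t
  define r' where "r' t = 5 * \<rho> t ^ 4 * \<rho>' t" for t
  have r': "(r has_real_derivative r' t) (at t within {0..1})" if "t \<in> {1 - \<epsilon><..1}" for t
    unfolding r_def r'_def by (rule derivative_eq_intros \<rho>'[OF that] refl)+ simp
  define A where "A x = integral {0..x} r" for x
  define k where "k x = integral {0..x} (\<lambda>t. t\<^sup>2 * r t)" for x
  have int: "r integrable_on {0..x}" "(\<lambda>t. t\<^sup>2 * r t) integrable_on {0..x}" if "x \<le> 1" for x
    using integrable_profile[of "\<lambda>_. 1" x] integrable_profile[of "\<lambda>t. t\<^sup>2" x] that
    by (simp_all add: r_def[abs_def] continuous_intros)
  have A': "(A has_real_derivative r t) (at t within {0..1})" if "t \<in> {1 - \<epsilon><..1}" for t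
    using integral_has_vector_derivative_continuous_at[OF int(1)[OF order_refl], of t "{}"] that \<epsilon> DERIV_continuous[OF r'[OF that]]
    by (simp add: A_def[abs_def] has_real_derivative_iff_has_vector_derivative)
  have k': "(k has_real_derivative t\<^sup>2 * r t) (at t within {0..1})" if "t \<in> {1 - \<epsilon><..1}" for t
    using integral_has_vector_derivative_continuous_at[OF int(2)[OF order_refl], of t "{}"] that \<epsilon> DERIV_continuous[OF r'[OF that]]
    by (simp add: k_def[abs_def] has_real_derivative_iff_has_vector_derivative continuous_intros)
  have P: "P x = A x - k x / x\<^sup>2" if "x \<le> 1" for x
  proof -
    have "P x = integral {0..x} (\<lambda>t. r t - t\<^sup>2 * r t / x\<^sup>2)"
      by (simp add: P_def r_def algebra_simps)
    also have "\<dots> = A x - k x / x\<^sup>2"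
      unfolding A_def k_def
      by (intro integral_unique has_integral_diff has_integral_divide integrable_integral int[OF that])
    finally show ?thesis .
  qed
  define x where "x y = 1 / sqrt (1 + y)" for y :: real
  have x': "(x has_real_derivative - (x y ^ 3 / 2)) (at y)" if "0 < y" for y
  proof -
    have "((\<lambda>y. sqrt (1 + y)) has_real_derivative 1 / (2 * sqrt (1 + y))) (at y)"
      using that by (auto intro!: derivative_eq_intros simp: field_simps)
    moreover have "sqrt (1 + y) \<noteq> 0" using that by simp
    ultimately have "((\<lambda>y. inverse (sqrt (1 + y))) has_real_derivative
        - (inverse (sqrt (1 + y)) * (1 / (2 * sqrt (1 + y))) * inverse (sqrt (1 + y)))) (at y)" by (rule DERIV_inverse')
    moreover have "inverse s * (1 / (2 * s)) * inverse s = (1 / s) ^ 3 / 2" for s :: real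
      by (cases "s = 0") (simp_all add: field_simps power3_eq_cube)
    moreover have "(\<lambda>y. inverse (sqrt (1 + y))) = x" by (simp add: x_def fun_eq_iff inverse_eq_divide)
    ultimately show ?thesis unfolding x_def by (simp only:)
  qed
  have x_lt: "0 < x y" "x y < 1" if "0 < y" for y
    using that by (auto simp: x_def)
  have "((\<lambda>y. x y) \<longlongrightarrow> 1 / sqrt (1 + 0)) (at_right 0)"
    unfolding x_def by (intro tendsto_intros) auto
  then have x_tendsto: "(x \<longlongrightarrow> 1) (at_right 0)" by simp
  \<comment> \<open>\<open>x y\<close> approaches 1 inside \<open>{0..1}\<close> without reaching
    it, so one-sided continuity at 1 yields limits as \<open>y\<close> tends to 0 from the
    right.\<close>
  have x_lim: "filterlim x (at 1 within {0..1}) (at_right 0)"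
  proof -
    have "\<forall>\<^sub>F y in at_right 0. x y \<in> {0..1} \<and> x y \<noteq> 1"
    proof (rule eventually_at_rightI[of 0 1])
      fix y :: real assume "y \<in> {0<..<1}"
      then show "x y \<in> {0..1} \<and> x y \<noteq> 1" using x_lt[of y] by simp
    qed simp
    with x_tendsto show ?thesis by (simp add: filterlim_at)
  qed
  have "\<forall>\<^sub>F y in at_right 0. 1 - \<epsilon> < x y" using x_tendsto \<epsilon> by (intro order_tendstoD) auto
  then obtain d where d: "0 < d" "\<And>y. 0 < y \<Longrightarrow> y < d \<Longrightarrow> 1 - \<epsilon> < x y"
    by (auto simp: eventually_at_right[of 0 1])
  have xI: "x y \<in> {1 - \<epsilon><..1}" if "0 < y" "y < d" for y using d(2)[OF that] x_lt that by (auto intro: less_imp_le)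
  \<comment> \<open>For positive \<open>y\<close> the point \<open>x y\<close> is interior to
    \<open>{0..1}\<close>, so derivatives relative to the interval are two-sided and fit the chain
    rule.\<close>
  have at: "at (x y) within {0..1} = at (x y)" if "0 < y" for y
    using x_lt[OF that] by (intro at_within_Icc_at)
  have dx: "((\<lambda>y. f (x y)) has_real_derivative f' * - (x y ^ 3 / 2)) (at y)"
    if "(f has_real_derivative f') (at (x y) within {0..1})" "0 < y" for f f' y
    using DERIV_chain2[OF _ x'] that at by metis
  have lim: "((\<lambda>y. f (x y)) \<longlongrightarrow> f 1) (at_right 0)" if "(f has_real_derivative f') (at 1 within {0..1})" for f f'
    using filterlim_compose[OF _ x_lim] DERIV_continuous[OF that] by (simp add: continuous_within)
  have one: "1 \<in> {1 - \<epsilon><..1}" using \<epsilon> by simp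
  show ?thesis
  proof (rule that[of d "\<lambda>y. k (x y)" "\<lambda>y. x y ^ 5 * r (x y) / 2" "\<lambda>y. - (x y ^ 3 * (5 * x y ^ 4 * r (x y) + x y ^ 5 * r' (x y)) / 4)"])
    fix y assume y: "0 < y" "y < d"
    show "((\<lambda>y. k (x y)) has_real_derivative - (x y ^ 5 * r (x y) / 2)) (at y)"
      using dx[OF k'[OF xI[OF y]] y(1)] by (simp add: power_def mult_ac)
    have "((\<lambda>t. t ^ 5 * r t) has_real_derivative 5 * x y ^ 4 * r (x y) + x y ^ 5 * r' (x y)) (at (x y) within {0..1})"
      by (rule derivative_eq_intros r'[OF xI[OF y]] refl)+ simp
    from DERIV_cdivide[OF dx[OF this y(1)], of 2]
    show "((\<lambda>y. x y ^ 5 * r (x y) / 2) has_real_derivative - (x y ^ 3 * (5 * x y ^ 4 * r (x y) + x y ^ 5 * r' (x y)) / 4)) (at y)"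
      by (simp add: mult_ac)
    have x0: "x y \<noteq> 0" using x_lt[OF y(1)] by simp
    have "((\<lambda>t. A t - k t / t\<^sup>2) has_real_derivative 2 * k (x y) / x y ^ 3) (at (x y) within {0..1})"
    proof -
      have sq: "((\<lambda>t. t\<^sup>2) has_real_derivative 2 * x y) (at (x y) within {0..1})"
        by (auto intro!: derivative_eq_intros)
      have "(x y)\<^sup>2 \<noteq> 0" using x0 by simp
      note DERIV_diff[OF A'[OF xI[OF y]] DERIV_divide[OF k'[OF xI[OF y]] sq this]]
      \<comment> \<open>The terms with \<open>r\<close> cancel because the weight
        \<open>1 - t\<^sup>2 / x\<^sup>2\<close> vanishes at the moving endpoint
        \<open>t = x\<close>.\<close>
      moreover have "r (x y) - ((x y)\<^sup>2 * r (x y) * (x y)\<^sup>2 - k (x y) * (2 * x y)) / ((x y)\<^sup>2 * (x y)\<^sup>2) = 2 * k (x y) / x y ^ 3"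
        using x0 by (simp add: field_simps power2_eq_square power3_eq_cube)
      ultimately show ?thesis by (simp only:)
    qed
    from dx[OF this y(1)]
    have "((\<lambda>y. A (x y) - k (x y) / (x y)\<^sup>2) has_real_derivative - k (x y)) (at y)"
      using x0 by simp
    then show "((\<lambda>y. P (1 / sqrt (1 + y))) has_real_derivative - k (x y)) (at y)"
      by (rule has_field_derivative_transform_within_open[where S = "{0<..}"])
        (use y x_lt in \<open>auto simp: P less_imp_le simp flip: x_def\<close>)
  next
    have "((\<lambda>y. A (x y) - k (x y) / (x y)\<^sup>2) \<longlongrightarrow> A 1 - k 1 / 1\<^sup>2) (at_right 0)"
      by (intro tendsto_intros lim[OF A'[OF one]] lim[OF k'[OF one]] x_tendsto) simp
    moreover have "\<forall>\<^sub>F y in at_right 0. A (x y) - k (x y) / (x y)\<^sup>2 = P (1 / sqrt (1 + y))"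
      using x_lt by (intro eventually_at_rightI[of 0 1]) (auto simp: P less_imp_le simp flip: x_def)
    moreover have "A 1 - k 1 / 1\<^sup>2 = h_fun K 1"
      using P[of 1] by (simp add: P_def h_fun_def mult.commute)
    ultimately show "((\<lambda>y. P (1 / sqrt (1 + y))) \<longlongrightarrow> h_fun K 1) (at_right 0)"
      by (auto intro: Lim_transform_eventually)
    show "((\<lambda>y. k (x y)) \<longlongrightarrow> k_one K) (at_right 0)"
      using lim[OF k'[OF one]] by (simp add: k_def k_one_def r_def)
    have r1: "((\<lambda>y. r (x y)) \<longlongrightarrow> r 1) (at_right 0)" by (rule lim[OF r'[OF one]])
    have "((\<lambda>y. x y ^ 5 * r (x y) / 2) \<longlongrightarrow> 1 ^ 5 * r 1 / 2) (at_right 0)"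
      by (intro tendsto_intros r1 x_tendsto) simp
    then show "((\<lambda>y. x y ^ 5 * r (x y) / 2) \<longlongrightarrow> r_fun K 1 / 2) (at_right 0)"
      by (simp add: r_def r_fun_def)
    \<comment> \<open>Continuity of \<rho>' at 1, needed for this limit, comes from its
      differentiability there.\<close>
    have "((\<lambda>y. - (x y ^ 3 * (5 * x y ^ 4 * r (x y) + x y ^ 5 * (5 * \<rho> (x y) ^ 4 * \<rho>' (x y))) / 4)) \<longlongrightarrow>
       - (1 ^ 3 * (5 * 1 ^ 4 * r 1 + 1 ^ 5 * (5 * \<rho> 1 ^ 4 * \<rho>' 1)) / 4)) (at_right 0)"
      by (intro tendsto_intros r1 x_tendsto lim[OF \<rho>'[OF one]] lim[OF \<rho>''[OF one]]) simp
    moreover have "5 * r 1 + 5 * \<rho> 1 ^ 4 * \<rho>' 1 = 5 * \<rho> 1 ^ 4 * (\<rho> 1 + \<rho>' 1)"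
      by (simp add: r_def power_Suc2[symmetric] algebra_simps numeral_eq_Suc)
    ultimately show "((\<lambda>y. - (x y ^ 3 * (5 * x y ^ 4 * r (x y) + x y ^ 5 * r' (x y)) / 4)) \<longlongrightarrow> 0) (at_right 0)"
      by (simp add: r'_def flat')
  qed (rule d)
qed

text \<open>The profile is bounded below by some \<open>e > 0\<close>, so the integral is at least
  \<open>e ^ 5 / 3\<close>.\<close>

lemma k_one_pos: "0 < k_one K"
proof -
  obtain e B where e: "0 < e" "\<And>t. 0 \<le> t \<Longrightarrow> t \<le> 1 \<Longrightarrow> e \<le> \<rho> t \<and> \<rho> t \<le> B"
    using profile_bounds by blast
  have "((\<lambda>t. t\<^sup>2 * e ^ 5) has_integral 1 ^ 3 / 3 * e ^ 5 - 0 ^ 3 / 3 * e ^ 5) {0..1}"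
    by (intro fundamental_theorem_of_calculus)
       (auto simp: has_real_derivative_iff_has_vector_derivative[symmetric] intro!: derivative_eq_intros)
  moreover have "((\<lambda>t. t\<^sup>2 * \<rho> t ^ 5) has_integral k_one K) {0..1}"
    unfolding k_one_def by (intro integrable_integral integrable_profile continuous_intros) simp
  ultimately have "1 ^ 3 / 3 * e ^ 5 - 0 ^ 3 / 3 * e ^ 5 \<le> k_one K"
    by (rule has_integral_le) (use e in \<open>auto intro!: mult_left_mono power_mono\<close>)
  then have "e ^ 5 / 3 \<le> k_one K" by simp
  with zero_less_power[OF e(1), of 5] show ?thesis by linarith
qed

end

theorem corollary5:
  fixes K :: "(real^6) set"
  assumes "convex_body K"
    and "origin_symmetric K"
    and "body_of_revolution K"
    and "C2_near_1 (radial_profile K)"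
    and "radial_profile K 1 + vector_derivative (radial_profile K) (at 1 within {0..1}) = 0"
    and "2 * (k_one K)\<^sup>2 < h_fun K 1 * r_fun K 1"
  shows "\<not> polar_zonoid (intersection_body K)"
proof
  assume pz: "polar_zonoid (intersection_body K)"
  interpret revolution_body K using assms(1-3) by unfold_locales
  obtain d k q T where calc: "0 < d"
    "\<And>y. 0 < y \<Longrightarrow> y < d \<Longrightarrow> ((\<lambda>y. P (1 / sqrt (1 + y))) has_real_derivative - k y) (at y)"
    "\<And>y. 0 < y \<Longrightarrow> y < d \<Longrightarrow> (k has_real_derivative - q y) (at y)"
    "\<And>y. 0 < y \<Longrightarrow> y < d \<Longrightarrow> (q has_real_derivative T y) (at y)"
    "((\<lambda>y. P (1 / sqrt (1 + y))) \<longlongrightarrow> h_fun K 1) (at_right 0)" "(k \<longlongrightarrow> k_one K) (at_right 0)"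
    "(q \<longlongrightarrow> r_fun K 1 / 2) (at_right 0)" "(T \<longlongrightarrow> 0) (at_right 0)"
    by (rule profile_calculus[OF assms(4,5)]) blast
  obtain m C where m: "0 < C" "sets m = sets borel" "finite_measure m" "AE \<beta> in m. 0 \<le> \<beta> \<and> \<beta> \<le> 1"
    and int: "\<And>z. 0 < z \<Longrightarrow> integrable m (\<lambda>\<beta>. zonal_kernel (sqrt (1 - \<beta>\<^sup>2)) (z * \<beta>))"
    and rep: "\<And>z. 0 < z \<Longrightarrow> C / P (1 / sqrt (1 + z\<^sup>2)) = (\<integral>\<beta>. zonal_kernel (sqrt (1 - \<beta>\<^sup>2)) (z * \<beta>) \<partial>m)"
    by (rule polar_zonoid_zonal_representation[OF pz]) blast
  have "0 < \<rho> 1" using profile_ext_pos[of 1] by (simp add: profile_ext_eq)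
  then have "0 < r_fun K 1" by (simp add: r_fun_def)
  \<comment> \<open>The left side of the strict inequality is nonnegative, so positivity of h(1)
    follows from that of r(1).\<close>
  moreover have "0 < h_fun K 1 * r_fun K 1" using assms(6) by (smt (verit) zero_le_power2)
  ultimately have H: "0 < h_fun K 1" by (simp add: zero_less_mult_iff)
  obtain \<delta> g' g'' where \<delta>: "0 < \<delta>"
    and g': "\<And>z. 0 < z \<Longrightarrow> z < \<delta> \<Longrightarrow> ((\<lambda>z. C / P (1 / sqrt (1 + z\<^sup>2))) has_real_derivative g' z) (at z)"
    and g'': "\<And>z. 0 < z \<Longrightarrow> z < \<delta> \<Longrightarrow> (g' has_real_derivative g'' z) (at z)"
    and cont: "\<And>z. 0 < z \<Longrightarrow> z < \<delta> \<Longrightarrow> isCont g'' z"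
    and not_convex: "\<not> convex_on {0<..<\<delta>\<^sup>2} (\<lambda>y. g'' (sqrt y))"
    by (rule second_derivative_not_convex[OF calc(1) m(1) calc(2-8) H k_one_pos assms(6)]) blast+
  \<comment> \<open>This identifies \<open>g''\<close>, obtained from the profile near the axis,
    with the integral of \<open>zonal_kernel''\<close>, from which it inherits convexity.\<close>
  note second = zonal_representation_second_derivative[OF m(3,2,4) int rep g' g'' cont]
  have "convex_on {0<..<\<delta>\<^sup>2} (\<lambda>y. g'' (sqrt y))"
    by (rule convex_on_zonal_second_derivative[OF \<delta> m(4)]) (rule second; simp)+
  with not_convex show False ..
qed

end
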